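(* Let $P$ be a poset which is Gorenstein$^\ast$ over $\mathbb{Z}_2$, and let $\nu$ be an automorphism of $P$ with $\nu^2=\mathrm{id}$. Then the subposet of $P$ induced by the set of fixed points of $\nu$ is Gorenstein$^\ast$ over $\mathbb{Z}_2$.
   Context: A poset is bounded if it has a unique minimum $\hat 0$ and maximum $\hat 1$. For a bounded poset or interval, topological properties refer to the order complex (simplicial complex of chains) of its proper part (the poset with $\hat 0,\hat 1$ removed). A poset $P$ is Gorenstein$^\ast$ over $\mathbb{Z}_2$ if it is bounded, graded and finite, and every interval $[p,q]\subseteq P$ is a homology sphere over $\mathbb{Z}_2$ of top dimension, i.e. the order complex of the open interval $(p,q)$ has reduced homology with $\mathbb{Z}_2$ coefficients isomorphic to $\mathbb{Z}_2$ in degree $\rho(q)-\rho(p)-2$ and zero in all other degrees, where $\rho$ is the rank function. *)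

theory Defs
  imports
    "HOL-Library.Poly_Mapping"
    "HOL-Library.Z2"
    "HOL-Algebra.Elementary_Groups"
begin

section \<open>Reduced simplicial homology over the two-element field\<close>

text \<open>
  A simplicial complex is a downward closed family \<open>K\<close> of finite vertex sets that contains the
  empty set, which is its only face of dimension \<open>-1\<close>.  A chain with coefficients in \<^typ>\<open>bit\<close>
  (the field with two elements) is a finitely supported function on faces, and the dimension of
  a face is its cardinality minus one.  Degrees are integers, so that \<open>-1\<close> and \<open>-2\<close> make sense.
\<close>

definition simplicial_chains :: "'a set set \<Rightarrow> int \<Rightarrow> ('a set \<Rightarrow>\<^sub>0 bit) set" where
  "simplicial_chains K d = {c. Poly_Mapping.keys c \<subseteq> {\<sigma> \<in> K. int (card \<sigma>) = d + 1}}"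

text \<open>
  No signs are needed in characteristic two.  The face \<open>\<sigma> - {x}\<close> of a vertex \<open>\<sigma> = {x}\<close> is the
  empty face, so this is the boundary map of the augmented chain complex.
\<close>

definition boundary :: "('a set \<Rightarrow>\<^sub>0 bit) \<Rightarrow> ('a set \<Rightarrow>\<^sub>0 bit)" where
  "boundary c = (\<Sum>\<sigma> \<in> Poly_Mapping.keys c. \<Sum>x \<in> \<sigma>.
     Poly_Mapping.single (\<sigma> - {x}) (Poly_Mapping.lookup c \<sigma>))"

definition cycle_group :: "'a set set \<Rightarrow> int \<Rightarrow> ('a set \<Rightarrow>\<^sub>0 bit) monoid" where
  "cycle_group K d = \<lparr>carrier = {c \<in> simplicial_chains K d. boundary c = 0}, mult = (+), one = 0\<rparr>"

definition reduced_homology :: "'a set set \<Rightarrow> int \<Rightarrow> ('a set \<Rightarrow>\<^sub>0 bit) set monoid" where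
  "reduced_homology K d = cycle_group K d Mod (boundary ` simplicial_chains K (d + 1))"

text \<open>
  The homology groups are elementary abelian two-groups, so an isomorphism of groups is the same
  as an isomorphism of vector spaces over the two-element field.  With \<open>d = -1\<close> the complex whose
  only face is the empty set is a homology sphere.
\<close>

definition homology_sphere :: "'a set set \<Rightarrow> int \<Rightarrow> bool" where
  "homology_sphere K d \<longleftrightarrow>
     reduced_homology K d \<cong> integer_mod_group 2 \<and>
     (\<forall>i. i \<noteq> d \<longrightarrow> trivial_group (reduced_homology K i))"


section \<open>Posets\<close>

text \<open>
  A poset is a carrier \<open>P\<close> with a relation \<open>r\<close> such that \<^term>\<open>partial_order_on P r\<close>; in
  particular \<open>r\<close> relates only elements of \<open>P\<close>.  The subposet induced by \<open>F \<subseteq> P\<close> is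
  \<open>(F, Restr r F)\<close>.
\<close>

definition bounded_poset :: "'a set \<Rightarrow> 'a rel \<Rightarrow> bool" where
  "bounded_poset P r \<longleftrightarrow> partial_order_on P r \<and>
     (\<exists>a\<in>P. \<forall>x\<in>P. (a, x) \<in> r) \<and> (\<exists>b\<in>P. \<forall>x\<in>P. (x, b) \<in> r)"

definition open_interval :: "'a rel \<Rightarrow> 'a \<Rightarrow> 'a \<Rightarrow> 'a set" where
  "open_interval r p q = {x. (p, x) \<in> r \<and> x \<noteq> p \<and> (x, q) \<in> r \<and> x \<noteq> q}"

definition covers :: "'a rel \<Rightarrow> 'a \<Rightarrow> 'a \<Rightarrow> bool" where
  "covers r p q \<longleftrightarrow> (p, q) \<in> r \<and> p \<noteq> q \<and> open_interval r p q = {}"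

text \<open>
  A finite bounded poset is graded iff it has a rank function, equivalently iff all of its maximal
  chains have the same length; the rank function is then unique on \<open>P\<close>.
\<close>

definition rank_function :: "'a set \<Rightarrow> 'a rel \<Rightarrow> ('a \<Rightarrow> nat) \<Rightarrow> bool" where
  "rank_function P r \<rho> \<longleftrightarrow>
     (\<forall>x\<in>P. (\<forall>y\<in>P. (y, x) \<in> r \<longrightarrow> y = x) \<longrightarrow> \<rho> x = 0) \<and>
     (\<forall>p\<in>P. \<forall>q\<in>P. covers r p q \<longrightarrow> \<rho> q = Suc (\<rho> p))"

definition order_complex :: "'a set \<Rightarrow> 'a rel \<Rightarrow> 'a set set" where
  "order_complex A r = {\<sigma> \<in> Chains r. finite \<sigma> \<and> \<sigma> \<subseteq> A}"

text \<open>
  The intervals \<open>[p, q]\<close> are those with \<open>p < q\<close>: for \<open>p = q\<close> the minimum and maximum of the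
  interval coincide and there is no complex of dimension \<open>-2\<close>.
\<close>

definition gorenstein_star :: "'a set \<Rightarrow> 'a rel \<Rightarrow> bool" where
  "gorenstein_star P r \<longleftrightarrow> finite P \<and> bounded_poset P r \<and>
     (\<exists>\<rho>. rank_function P r \<rho> \<and>
       (\<forall>p\<in>P. \<forall>q\<in>P. (p, q) \<in> r \<and> p \<noteq> q \<longrightarrow>
         homology_sphere (order_complex (open_interval r p q) r) (int (\<rho> q) - int (\<rho> p) - 2)))"

definition poset_automorphism :: "'a set \<Rightarrow> 'a rel \<Rightarrow> ('a \<Rightarrow> 'a) \<Rightarrow> bool" where
  "poset_automorphism P r \<nu> \<longleftrightarrow>
     bij_betw \<nu> P P \<and> (\<forall>x\<in>P. \<forall>y\<in>P. (x, y) \<in> r \<longleftrightarrow> (\<nu> x, \<nu> y) \<in> r)"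

definition fixed_points :: "'a set \<Rightarrow> ('a \<Rightarrow> 'a) \<Rightarrow> 'a set" where
  "fixed_points P \<nu> = {x \<in> P. \<nu> x = x}"

end

theory Submission
  imports Defs
begin

text \<open>
  Let \<open>\<nu>\<close> act on the order complex \<open>K\<close> of an open interval with fixed end points; a chain mapped to
  itself is fixed pointwise, so the fixed subcomplex \<open>F\<close> is the order complex of the fixed points.
  On the ungraded chains over the two-element field, \<open>D = \<partial> + 1 + \<nu>\<close> is a differential. The map
  \<open>1 + \<nu>\<close> is exact on the chains modulo those of \<open>F\<close>, so clearing faces outside \<open>F\<close> from the top
  dimension downwards shows that \<open>D\<close>-homology of \<open>K\<close> is the total homology of \<open>F\<close>; clearing from the
  bottom dimension upwards with \<open>\<partial>\<close> instead shows that it is one-dimensional whenever the homology of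
  \<open>K\<close> is. Hence \<open>F\<close> is a homology sphere of some dimension.

  It remains to see that the dimensions come from a rank function. In a finite poset all of whose
  open intervals are homology spheres, put \<open>R p q\<close> for the dimension of \<open>(p, q)\<close> plus two. By
  induction, \<open>h x = R p x + R x q\<close> takes the same value on comparable elements of \<open>(p, q)\<close>, and if
  \<open>h x = k > 2\<close> then the sum of all chains with \<open>k - 1\<close> elements on which \<open>h = k\<close> is a cycle that is
  not a boundary, so \<open>R p q = k\<close>. If \<open>h x = 2\<close> then \<open>x\<close> is an isolated point of the complex, which
  forces \<open>R p q = 2\<close>. So \<open>R\<close> is additive, and \<open>R\<close> measured from the minimum is the rank function.
\<close>

section \<open>Chains over the two-element field\<close>

abbreviation cell :: "'k \<Rightarrow> 'k \<Rightarrow>\<^sub>0 bit" where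
  "cell k \<equiv> Poly_Mapping.single k 1"

lemma bit_chain_double [simp]: "x + x = (0 :: 'k \<Rightarrow>\<^sub>0 bit)"
  by (rule poly_mapping_eqI) (simp add: lookup_add flip: mult_2)

lemma bit_chain_double_left [simp]: "x + (x + y) = (y :: 'k \<Rightarrow>\<^sub>0 bit)"
  by (simp flip: add.assoc)

lemma bit_chain_add_eq_iff: "x + y = z \<longleftrightarrow> x = z + (y :: 'k \<Rightarrow>\<^sub>0 bit)"
  by (auto simp: add.assoc)

lemma lookup_bit: "Poly_Mapping.lookup c k = (if k \<in> Poly_Mapping.keys c then 1 else (0::bit))"
  by (simp add: in_keys_iff)

lemma keys_add_bit: "Poly_Mapping.keys (x + y :: 'k \<Rightarrow>\<^sub>0 bit) = sym_diff (Poly_Mapping.keys x) (Poly_Mapping.keys y)"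
  by (auto simp: in_keys_iff lookup_add)

lemma chain_eqI: "Poly_Mapping.keys x = Poly_Mapping.keys y \<Longrightarrow> x = (y :: 'k \<Rightarrow>\<^sub>0 bit)"
  by (rule poly_mapping_eqI) (simp add: lookup_bit)

lemma lookup_cell: "Poly_Mapping.lookup (cell k) l = (if k = l then 1 else 0)"
  by (simp add: lookup_single when_def)

lemma chain_eq_sum_cells: "c = (\<Sum>k\<in>Poly_Mapping.keys c. cell k)"
proof (rule poly_mapping_eqI)
  fix k
  show "Poly_Mapping.lookup c k = Poly_Mapping.lookup (\<Sum>k\<in>Poly_Mapping.keys c. cell k) k"
    by (simp add: lookup_sum lookup_cell lookup_bit[of c])
qed

lemma chain_induct [consumes 1, case_names zero add]:
  fixes c :: "'k \<Rightarrow>\<^sub>0 bit"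
  assumes "Poly_Mapping.keys c \<subseteq> K"
    and "Q 0"
    and "\<And>k c. k \<in> K \<Longrightarrow> Poly_Mapping.keys c \<subseteq> K \<Longrightarrow> Q c \<Longrightarrow> Q (cell k + c)"
  shows "Q c"
proof -
  have "Poly_Mapping.keys (sum cell A) \<subseteq> K \<and> Q (sum cell A)" if "finite A" "A \<subseteq> K" for A
    using that
  proof (induction A rule: finite_induct)
    case (insert k A)
    then show ?case
      using assms(3)[of k "sum cell A"] keys_add[of "cell k" "sum cell A"] by auto
  qed (use assms in auto)
  from this[of "Poly_Mapping.keys c"] show ?thesis
    using assms(1) unfolding chain_eq_sum_cells[symmetric] by simp
qed

text \<open>The linear extension of a map given on basis cells. Nonzero coefficients in
  \<open>bit\<close> equal one, so a sum over the support suffices.\<close>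

definition lin :: "('k \<Rightarrow> 'l \<Rightarrow>\<^sub>0 bit) \<Rightarrow> ('k \<Rightarrow>\<^sub>0 bit) \<Rightarrow> 'l \<Rightarrow>\<^sub>0 bit" where
  "lin f c = (\<Sum>k\<in>Poly_Mapping.keys c. f k)"

lemma lin_0 [simp]: "lin f 0 = 0"
  by (simp add: lin_def)

lemma lin_cell [simp]: "lin f (cell k) = f k"
  by (simp add: lin_def)

text \<open>Cells common to both supports are counted twice on the right and cancel. What survives
  is the sum over the symmetric difference, which is the support of \<open>x + y\<close>.\<close>

lemma lin_add [simp]: "lin f (x + y) = lin f x + lin f y"
proof -
  let ?X = "Poly_Mapping.keys x" and ?Y = "Poly_Mapping.keys y"
  have "lin f x = sum f (?X - ?Y) + sum f (?X \<inter> ?Y)" "lin f y = sum f (?Y - ?X) + sum f (?X \<inter> ?Y)"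
    unfolding lin_def
    using sum.Int_Diff[of ?X f ?Y] sum.Int_Diff[of ?Y f ?X] by (simp_all add: Int_commute add.commute)
  moreover have "lin f (x + y) = sum f (?X - ?Y) + sum f (?Y - ?X)"
    unfolding lin_def keys_add_bit by (subst sum.union_disjoint) auto
  ultimately show ?thesis
    by (simp add: ac_simps)
qed

lemma lin_sum [simp]: "lin f (sum g A) = (\<Sum>a\<in>A. lin f (g a))"
  by (induction A rule: infinite_finite_induct) auto

lemma keys_lin: "Poly_Mapping.keys (lin f c) \<subseteq> (\<Union>k\<in>Poly_Mapping.keys c. Poly_Mapping.keys (f k))"
  unfolding lin_def by (rule keys_sum)

lemma keys_linD:
  assumes "l \<in> Poly_Mapping.keys (lin f c)"
  obtains k where "k \<in> Poly_Mapping.keys c" "l \<in> Poly_Mapping.keys (f k)"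
  using assms keys_lin by fastforce

definition restrict_chain :: "('k \<Rightarrow> bool) \<Rightarrow> ('k \<Rightarrow>\<^sub>0 bit) \<Rightarrow> 'k \<Rightarrow>\<^sub>0 bit" where
  "restrict_chain Q = lin (\<lambda>k. if Q k then cell k else 0)"

lemma lookup_restrict_chain:
  "Poly_Mapping.lookup (restrict_chain Q c) k = (if Q k then Poly_Mapping.lookup c k else 0)"
proof -
  have "Poly_Mapping.lookup (restrict_chain Q c) k
      = (\<Sum>l\<in>Poly_Mapping.keys c. if l = k then (if Q l then 1 else 0) else 0)"
    unfolding restrict_chain_def lin_def lookup_sum
    by (rule sum.cong) (auto simp: lookup_cell)
  then show ?thesis
    by (simp add: lookup_bit)
qed

lemma keys_restrict_chain [simp]:
  "Poly_Mapping.keys (restrict_chain Q c) = {k \<in> Poly_Mapping.keys c. Q k}"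
  by (auto simp: in_keys_iff lookup_restrict_chain split: if_splits)

lemma restrict_chain_add_compl: "restrict_chain Q c + restrict_chain (\<lambda>k. \<not> Q k) c = c"
  by (rule chain_eqI) (auto simp: keys_add_bit)

lemma restrict_chain_triv: "(\<And>k. k \<in> Poly_Mapping.keys c \<Longrightarrow> Q k) \<Longrightarrow> restrict_chain Q c = c"
  by (rule chain_eqI) auto

lemma restrict_chain_zero: "(\<And>k. k \<in> Poly_Mapping.keys c \<Longrightarrow> \<not> Q k) \<Longrightarrow> restrict_chain Q c = 0"
  by (rule chain_eqI) auto

lemma restrict_chain_plus [simp]:
  "restrict_chain Q (x + y) = restrict_chain Q x + restrict_chain Q y"
  by (simp add: restrict_chain_def)

section \<open>The boundary operator\<close>

definition cell_boundary :: "'a set \<Rightarrow> 'a set \<Rightarrow>\<^sub>0 bit" where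
  "cell_boundary \<sigma> = (\<Sum>x\<in>\<sigma>. cell (\<sigma> - {x}))"

lemma boundary_eq_lin: "boundary = lin cell_boundary"
  by (simp add: fun_eq_iff boundary_def lin_def cell_boundary_def lookup_bit cong: sum.cong)

lemma boundary_0 [simp]: "boundary 0 = 0"
  and boundary_add [simp]: "boundary (x + y) = boundary x + boundary y"
  and boundary_cell [simp]: "boundary (cell \<sigma>) = cell_boundary \<sigma>"
  by (simp_all add: boundary_eq_lin)

text \<open>Removing distinct vertices gives distinct facets, so no terms cancel. For infinite
  \<open>\<sigma>\<close> the boundary is zero, the default value of a sum over an infinite
  set.\<close>

lemma keys_cell_boundary:
  "Poly_Mapping.keys (cell_boundary \<sigma>) = (if finite \<sigma> then (\<lambda>x. \<sigma> - {x}) ` \<sigma> else {})"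
proof (cases "finite \<sigma>")
  case True
  have inj: "inj_on (\<lambda>x. \<sigma> - {x}) \<sigma>"
    by (auto simp: inj_on_def)
  have "Poly_Mapping.lookup (cell_boundary \<sigma>) \<tau> = (if \<tau> \<in> (\<lambda>x. \<sigma> - {x}) ` \<sigma> then 1 else 0)" for \<tau>
  proof -
    have "Poly_Mapping.lookup (cell_boundary \<sigma>) \<tau> = (\<Sum>\<upsilon>\<in>(\<lambda>x. \<sigma> - {x}) ` \<sigma>. if \<upsilon> = \<tau> then 1 else 0)"
      by (simp add: cell_boundary_def lookup_sum lookup_cell sum.reindex[OF inj] cong: if_cong)
    then show ?thesis
      using True by simp
  qed
  then show ?thesis
    using True by (auto simp: in_keys_iff split: if_splits)
qed (simp add: cell_boundary_def)

text \<open>Each unordered pair contributes two equal terms.\<close>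

lemma sum_symmetric_eq_0:
  fixes f :: "'a \<Rightarrow> 'a \<Rightarrow> 'k \<Rightarrow>\<^sub>0 bit"
  assumes "finite A" and sym: "\<And>x y. f x y = f y x"
  shows "(\<Sum>x\<in>A. \<Sum>y\<in>A - {x}. f x y) = 0"
  using assms(1)
proof (induction A rule: finite_induct)
  case (insert a A)
  have "(\<Sum>y\<in>insert a A - {x}. f x y) = f x a + (\<Sum>y\<in>A - {x}. f x y)" if "x \<in> A" for x
  proof -
    have "insert a A - {x} = insert a (A - {x})"
      using insert that by auto
    then show ?thesis
      using insert by simp
  qed
  then have "(\<Sum>x\<in>A. \<Sum>y\<in>insert a A - {x}. f x y) = (\<Sum>x\<in>A. f x a)"
    using insert.IH by (simp add: sum.distrib)
  moreover have "insert a A - {a} = A"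
    using insert by auto
  ultimately show ?case
    using insert sym[of a] by simp
qed simp

lemma boundary_boundary [simp]: "boundary (boundary c) = 0"
proof -
  have comm: "\<sigma> - {x} - {y} = \<sigma> - {y} - {x}" for \<sigma> :: "'a set" and x y
    by blast
  have *: "boundary (cell_boundary \<sigma>) = 0" for \<sigma> :: "'a set"
  proof (cases "finite \<sigma>")
    case True
    \<comment> \<open>A face of codimension two arises from both orders of removing its two missing
      vertices.\<close>
    have "boundary (cell_boundary \<sigma>) = (\<Sum>x\<in>\<sigma>. \<Sum>y\<in>\<sigma> - {x}. cell (\<sigma> - {x} - {y}))"
      by (simp add: cell_boundary_def boundary_eq_lin)
    also have "\<dots> = 0"
      by (rule sum_symmetric_eq_0) (use True in \<open>simp_all add: comm\<close>)
    finally show ?thesis .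
  qed (simp add: cell_boundary_def)
  have "Poly_Mapping.keys c \<subseteq> UNIV"
    by simp
  then show ?thesis
    by (induction c rule: chain_induct) (auto simp: *)
qed

lemma keys_boundaryD:
  assumes "\<tau> \<in> Poly_Mapping.keys (boundary c)"
  obtains \<sigma> x where "\<sigma> \<in> Poly_Mapping.keys c" "finite \<sigma>" "x \<in> \<sigma>" "\<tau> = \<sigma> - {x}"
  using assms unfolding boundary_eq_lin
  by (elim keys_linD) (auto simp: keys_cell_boundary split: if_splits)

text \<open>The cofaces of \<open>\<tau>\<close> in \<open>c\<close> correspond to the vertices that
  can be added, and \<open>of_nat\<close> into \<open>bit\<close> takes the parity of their number.
  Finiteness excludes cofaces whose boundary is zero by default.\<close>

lemma lookup_boundary:
  assumes "\<And>\<sigma>. \<sigma> \<in> Poly_Mapping.keys c \<Longrightarrow> finite \<sigma>"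
  shows "Poly_Mapping.lookup (boundary c) \<tau> =
    of_nat (card {x. x \<notin> \<tau> \<and> insert x \<tau> \<in> Poly_Mapping.keys c})"
proof -
  let ?E = "{x. x \<notin> \<tau> \<and> insert x \<tau> \<in> Poly_Mapping.keys c}"
  let ?S = "{\<sigma> \<in> Poly_Mapping.keys c. \<tau> \<in> (\<lambda>x. \<sigma> - {x}) ` \<sigma>}"
  have "bij_betw (\<lambda>x. insert x \<tau>) ?E ?S"
  proof (rule bij_betw_imageI)
    show "inj_on (\<lambda>x. insert x \<tau>) ?E"
      by (auto simp: inj_on_def)
    show "(\<lambda>x. insert x \<tau>) ` ?E = ?S"
      by (auto simp: image_iff insert_absorb)
  qed
  then have "card ?E = card ?S"
    by (rule bij_betw_same_card)
  moreover have "Poly_Mapping.lookup (boundary c) \<tau> = (\<Sum>\<sigma>\<in>Poly_Mapping.keys c. if \<sigma> \<in> ?S then 1 else 0)"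
    unfolding boundary_eq_lin lin_def lookup_sum
    by (rule sum.cong) (use assms in \<open>auto simp: lookup_bit keys_cell_boundary\<close>)
  moreover have "(\<Sum>\<sigma>\<in>Poly_Mapping.keys c. if \<sigma> \<in> ?S then 1 else (0::bit)) = of_nat (card ?S)"
    by (subst sum.inter_filter[symmetric]) auto
  ultimately show ?thesis
    by simp
qed

section \<open>Homology spheres\<close>

definition simplicial_complex :: "'a set set \<Rightarrow> bool" where
  "simplicial_complex K \<longleftrightarrow> (\<forall>\<sigma>\<in>K. finite \<sigma> \<and> Pow \<sigma> \<subseteq> K)"

lemma simplicial_complexD:
  assumes "simplicial_complex K" "\<sigma> \<in> K"
  shows "finite \<sigma>" "\<tau> \<subseteq> \<sigma> \<Longrightarrow> \<tau> \<in> K"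
  using assms by (auto simp: simplicial_complex_def)

definition chains_on :: "'a set set \<Rightarrow> ('a set \<Rightarrow>\<^sub>0 bit) set" where
  "chains_on K = {c. Poly_Mapping.keys c \<subseteq> K}"

text \<open>Chains are indexed by the number of vertices of their faces, which is one more than the dimension.\<close>

abbreviation layer :: "'a set set \<Rightarrow> nat \<Rightarrow> 'a set set" where
  "layer K n \<equiv> {\<sigma> \<in> K. card \<sigma> = n}"

text \<open>A form of \<open>homology_sphere\<close> free of quotient groups: \<open>z\<close>
  represents the only nonzero class. The index \<open>n\<close> is the dimension plus one, so the
  complex with only the empty face has \<open>n = 0\<close>.\<close>

definition sphere_class :: "'a set set \<Rightarrow> nat \<Rightarrow> ('a set \<Rightarrow>\<^sub>0 bit) \<Rightarrow> bool" where
  "sphere_class K n z \<longleftrightarrow>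
     z \<in> chains_on (layer K n) \<and> boundary z = 0 \<and> z \<notin> boundary ` chains_on (layer K (Suc n)) \<and>
     (\<forall>j. \<forall>c \<in> chains_on (layer K j). boundary c = 0 \<longrightarrow>
        c \<in> boundary ` chains_on (layer K (Suc j)) \<or>
        (j = n \<and> c + z \<in> boundary ` chains_on (layer K (Suc j))))"

lemma chains_on_0 [simp]: "0 \<in> chains_on K"
  by (simp add: chains_on_def)

lemma chains_on_add [simp]: "x \<in> chains_on K \<Longrightarrow> y \<in> chains_on K \<Longrightarrow> x + y \<in> chains_on K"
  using keys_add[of x y] by (auto simp: chains_on_def)

lemma chains_on_mono: "x \<in> chains_on K \<Longrightarrow> K \<subseteq> L \<Longrightarrow> x \<in> chains_on L"
  by (auto simp: chains_on_def)

lemma chains_on_cell [simp]: "cell \<sigma> \<in> chains_on K \<longleftrightarrow> \<sigma> \<in> K"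
  by (simp add: chains_on_def)

lemma chains_on_boundary:
  assumes "simplicial_complex K" "c \<in> chains_on K"
  shows "boundary c \<in> chains_on K"
  using assms unfolding chains_on_def simplicial_complex_def
  by (auto elim!: keys_boundaryD)

lemma chains_on_layer_boundary:
  assumes "simplicial_complex K" "c \<in> chains_on (layer K (Suc n))"
  shows "boundary c \<in> chains_on (layer K n)"
proof -
  have "boundary c \<in> chains_on K"
    using assms chains_on_mono by (intro chains_on_boundary) auto
  moreover have "card \<tau> = n" if "\<tau> \<in> Poly_Mapping.keys (boundary c)" for \<tau>
    using that assms(2) by (auto elim!: keys_boundaryD simp: chains_on_def subset_iff)
  ultimately show ?thesis
    by (auto simp: chains_on_def)
qed

lemma simplicial_chains_eq: "simplicial_chains K (int n - 1) = chains_on (layer K n)"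
  by (simp add: simplicial_chains_def chains_on_def)

lemma simplicial_chains_eq_Suc: "simplicial_chains K (int n - 1 + 1) = chains_on (layer K (Suc n))"
  using simplicial_chains_eq[of K "Suc n"] by simp

lemma simplicial_chains_negative:
  assumes "d < - 1"
  shows "simplicial_chains K d = {0}"
proof -
  have *: "{\<sigma> \<in> K. int (card \<sigma>) = d + 1} = {}"
    using assms by auto
  show ?thesis
    unfolding simplicial_chains_def * by (auto intro: chain_eqI)
qed

section \<open>Quotient groups with two elements\<close>

lemma (in group) iso_integer_mod_group_2:
  assumes "carrier G = {\<one>, a}" "a \<noteq> \<one>"
  shows "G \<cong> integer_mod_group 2"
proof -
  have a: "a \<in> carrier G"
    using assms by simp
  \<comment> \<open>If \<open>a \<otimes> a\<close> were \<open>a\<close>, cancellation would give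
    \<open>a = \<one>\<close>.\<close>
  then have aa: "a \<otimes> a = \<one>"
    using assms by (metis insertE l_cancel_one' m_closed singletonD)
  define h where "h x = (if x = \<one> then 0 else 1 :: int)" for x
  have "h \<in> hom G (integer_mod_group 2)"
  proof (rule homI)
    fix x y assume "x \<in> carrier G" "y \<in> carrier G"
    then show "h (x \<otimes> y) = h x \<otimes>\<^bsub>integer_mod_group 2\<^esub> h y"
      using assms aa a by (auto simp: h_def)
  qed (auto simp: h_def carrier_integer_mod_group)
  moreover have "bij_betw h (carrier G) (carrier (integer_mod_group 2))"
    unfolding bij_betw_def carrier_integer_mod_group using assms by (auto simp: h_def inj_on_def)
  ultimately show ?thesis
    by (auto simp: is_iso_def iso_def)
qed

lemma iso_integer_mod_group_2D:
  assumes "G \<cong> integer_mod_group 2" "group G"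
  obtains a where "carrier G = {\<one>\<^bsub>G\<^esub>, a}" "a \<noteq> \<one>\<^bsub>G\<^esub>"
proof -
  interpret group G by fact
  let ?e = "\<one>\<^bsub>G\<^esub>"
  obtain h where h: "h \<in> iso G (integer_mod_group 2)"
    using assms by (auto simp: is_iso_def)
  have bij: "bij_betw h (carrier G) {0..<2}"
    using h by (simp add: iso_def carrier_integer_mod_group)
  then have "card (carrier G) = 2"
    using bij_betw_same_card by fastforce
  then obtain a where "carrier G = {?e, a}" "a \<noteq> ?e"
    using one_closed unfolding card_2_iff by (metis doubleton_eq_iff insertE singletonD)
  then show thesis
    using that by simp
qed

lemma (in normal) rcos_eq_self_iff: "x \<in> carrier G \<Longrightarrow> H #> x = H \<longleftrightarrow> x \<in> H"
  using is_subgroup coset_join1[of H x] coset_join2[of x H] by blast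

lemma (in normal) trivial_FactGroup_iff: "trivial_group (G Mod H) \<longleftrightarrow> carrier G \<subseteq> H"
proof -
  interpret Q: group "G Mod H"
    by (rule factorgroup_is_group)
  have "trivial_group (G Mod H) \<longleftrightarrow> (\<forall>x\<in>carrier G. H #> x = H)"
    by (auto simp: Q.trivial_group_subset carrier_FactGroup)
  then show ?thesis
    by (auto simp: rcos_eq_self_iff)
qed

text \<open>Cosets of \<open>c\<close> and \<open>z\<close> agree exactly when
  \<open>c \<otimes> inv z \<in> H\<close>, so the right-hand side says that there are two cosets,
  \<open>H\<close> and \<open>H #> z\<close>.\<close>

lemma (in normal) FactGroup_iso_integer_mod_group_2_iff:
  "G Mod H \<cong> integer_mod_group 2 \<longleftrightarrow>
     (\<exists>z\<in>carrier G. z \<notin> H \<and> (\<forall>c\<in>carrier G. c \<in> H \<or> c \<otimes> inv z \<in> H))"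
proof -
  interpret Q: group "G Mod H"
    by (rule factorgroup_is_group)
  have eq_iff: "H #> x = H #> y \<longleftrightarrow> x \<otimes> inv y \<in> H" if "x \<in> carrier G" "y \<in> carrier G" for x y
  proof -
    have "H #> x = H #> y \<longleftrightarrow> x \<in> H #> y"
      using that is_subgroup rcos_self[of x H] repr_independence[of x H y] by auto
    then show ?thesis
      using that rcos_module[OF is_group] by simp
  qed
  show ?thesis
  proof
    assume "G Mod H \<cong> integer_mod_group 2"
    then obtain A where "carrier (G Mod H) = {\<one>\<^bsub>G Mod H\<^esub>, A}" "A \<noteq> \<one>\<^bsub>G Mod H\<^esub>"
      using Q.is_group by (rule iso_integer_mod_group_2D)
    then have A: "(#>) H ` carrier G = {H, A}" "A \<noteq> H"
      by (simp_all add: carrier_FactGroup)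
    then obtain z where z: "z \<in> carrier G" "A = H #> z"
      by (metis imageE insertI1 insert_commute)
    have "c \<in> H \<or> c \<otimes> inv z \<in> H" if "c \<in> carrier G" for c
    proof -
      have "H #> c \<in> {H, H #> z}"
        using that A(1) z(2) by (metis imageI)
      then show ?thesis
        using that z rcos_eq_self_iff eq_iff by simp
    qed
    moreover have "z \<notin> H"
      using z A(2) rcos_eq_self_iff by simp
    ultimately show "\<exists>z\<in>carrier G. z \<notin> H \<and> (\<forall>c\<in>carrier G. c \<in> H \<or> c \<otimes> inv z \<in> H)"
      using z(1) by blast
  next
    assume "\<exists>z\<in>carrier G. z \<notin> H \<and> (\<forall>c\<in>carrier G. c \<in> H \<or> c \<otimes> inv z \<in> H)"
    then obtain z where z: "z \<in> carrier G" "z \<notin> H" "\<And>c. c \<in> carrier G \<Longrightarrow> c \<in> H \<or> c \<otimes> inv z \<in> H"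
      by blast
    have "H #> c \<in> {H, H #> z}" if "c \<in> carrier G" for c
      using that z(1) z(3)[OF that] rcos_eq_self_iff eq_iff by simp
    moreover have "H = H #> \<one>"
      using rcos_eq_self_iff[of \<one>] one_closed subgroup.one_closed[OF is_subgroup] by simp
    ultimately have "(#>) H ` carrier G = {H, H #> z}"
      using z(1) one_closed by (intro equalityI subsetI) (blast, metis imageI insertE singletonD)
    then have "carrier (G Mod H) = {\<one>\<^bsub>G Mod H\<^esub>, H #> z}"
      by (simp add: carrier_FactGroup)
    moreover have "H #> z \<noteq> \<one>\<^bsub>G Mod H\<^esub>"
      using z rcos_eq_self_iff by simp
    ultimately show "G Mod H \<cong> integer_mod_group 2"
      by (rule Q.iso_integer_mod_group_2)
  qed
qed

section \<open>Cycles modulo boundaries\<close>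

lemma comm_group_cycle_group: "comm_group (cycle_group K d)"
proof (rule comm_groupI)
  fix x assume "x \<in> carrier (cycle_group K d)"
  then show "\<exists>y\<in>carrier (cycle_group K d). y \<otimes>\<^bsub>cycle_group K d\<^esub> x = \<one>\<^bsub>cycle_group K d\<^esub>"
    by (auto simp: cycle_group_def)
qed (auto simp: cycle_group_def simplicial_chains_def ac_simps dest!: keys_add[THEN subsetD])

lemma inv_cycle_group:
  assumes "z \<in> carrier (cycle_group K d)"
  shows "inv\<^bsub>cycle_group K d\<^esub> z = z"
proof -
  interpret comm_group "cycle_group K d"
    by (rule comm_group_cycle_group)
  show ?thesis
    by (rule inv_equality) (use assms in \<open>auto simp: cycle_group_def\<close>)
qed

lemma normal_boundaries:
  assumes "simplicial_complex K"
  shows "boundary ` simplicial_chains K (d + 1) \<lhd> cycle_group K d"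
proof -
  interpret comm_group "cycle_group K d"
    by (rule comm_group_cycle_group)
  have sub: "boundary c \<in> simplicial_chains K d" if "c \<in> simplicial_chains K (d + 1)" for c
  proof -
    have "int (card (\<sigma> - {x})) = d + 1" if "\<sigma> \<in> Poly_Mapping.keys c" "x \<in> \<sigma>" for \<sigma> x
    proof -
      have "finite \<sigma>" "int (card \<sigma>) = d + 2"
        using that \<open>c \<in> _\<close> assms by (auto simp: simplicial_chains_def simplicial_complex_def)
      then show ?thesis
        using card_Suc_Diff1[of \<sigma> x] that by linarith
    qed
    moreover have "boundary c \<in> chains_on K"
      using that assms by (intro chains_on_boundary) (auto simp: simplicial_chains_def chains_on_def)
    ultimately show ?thesis
      by (auto elim!: keys_boundaryD simp: simplicial_chains_def chains_on_def subset_iff)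
  qed
  have "subgroup (boundary ` simplicial_chains K (d + 1)) (cycle_group K d)"
  proof (rule subgroupI)
    show "boundary ` simplicial_chains K (d + 1) \<subseteq> carrier (cycle_group K d)"
      using sub by (auto simp: cycle_group_def)
  next
    show "boundary ` simplicial_chains K (d + 1) \<noteq> {}"
      by (auto simp: simplicial_chains_def intro: exI[of _ 0])
  next
    fix a assume "a \<in> boundary ` simplicial_chains K (d + 1)"
    then show "inv\<^bsub>cycle_group K d\<^esub> a \<in> boundary ` simplicial_chains K (d + 1)"
      by (subst inv_cycle_group) (auto simp: cycle_group_def sub)
  next
    fix a b assume "a \<in> boundary ` simplicial_chains K (d + 1)" "b \<in> boundary ` simplicial_chains K (d + 1)"
    then obtain x y where "a = boundary x" "b = boundary y"
      "x \<in> simplicial_chains K (d + 1)" "y \<in> simplicial_chains K (d + 1)"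
      by blast
    then show "a \<otimes>\<^bsub>cycle_group K d\<^esub> b \<in> boundary ` simplicial_chains K (d + 1)"
      using keys_add[of x y]
      by (intro image_eqI[of _ _ "x + y"]) (auto simp: cycle_group_def simplicial_chains_def)
  qed
  then show ?thesis
    by (rule normal_iff_subgroup[THEN iffD2])
qed

lemma trivial_reduced_homology_iff:
  assumes "simplicial_complex K"
  shows "trivial_group (reduced_homology K d) \<longleftrightarrow>
    (\<forall>c\<in>simplicial_chains K d. boundary c = 0 \<longrightarrow> c \<in> boundary ` simplicial_chains K (d + 1))"
  unfolding reduced_homology_def normal.trivial_FactGroup_iff[OF normal_boundaries[OF assms]]
  by (auto simp: cycle_group_def)

lemma reduced_homology_iso_iff:
  assumes "simplicial_complex K"
  shows "reduced_homology K d \<cong> integer_mod_group 2 \<longleftrightarrow>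
    (\<exists>z\<in>simplicial_chains K d. boundary z = 0 \<and> z \<notin> boundary ` simplicial_chains K (d + 1) \<and>
      (\<forall>c\<in>simplicial_chains K d. boundary c = 0 \<longrightarrow>
        c \<in> boundary ` simplicial_chains K (d + 1) \<or> c + z \<in> boundary ` simplicial_chains K (d + 1)))"
proof -
  have 1: "carrier (cycle_group K d) = {c \<in> simplicial_chains K d. boundary c = 0}"
    by (simp add: cycle_group_def)
  \<comment> \<open>Every cycle is its own inverse, so the coset criterion becomes a condition on
    \<open>c + z\<close>.\<close>
  have 2: "c \<otimes>\<^bsub>cycle_group K d\<^esub> inv\<^bsub>cycle_group K d\<^esub> z = c + z"
    if "z \<in> simplicial_chains K d" "boundary z = 0" for c z
    using inv_cycle_group[of z K d] that by (simp add: cycle_group_def)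
  show ?thesis
    unfolding reduced_homology_def
      normal.FactGroup_iso_integer_mod_group_2_iff[OF normal_boundaries[OF assms]]
    by (rule iffI; elim bexE conjE; rule_tac x = z in bexI) (simp_all add: 1 2)
qed

lemma homology_sphere_iff:
  assumes K: "simplicial_complex K"
  shows "homology_sphere K d \<longleftrightarrow> (\<exists>n z. d = int n - 1 \<and> sphere_class K n z)"
proof
  assume sph: "homology_sphere K d"
  then obtain z where z: "z \<in> simplicial_chains K d" "boundary z = 0" "z \<notin> boundary ` simplicial_chains K (d + 1)"
    "\<And>c. c \<in> simplicial_chains K d \<Longrightarrow> boundary c = 0 \<Longrightarrow>
        c \<in> boundary ` simplicial_chains K (d + 1) \<or> c + z \<in> boundary ` simplicial_chains K (d + 1)"
    unfolding homology_sphere_def reduced_homology_iso_iff[OF K] by blast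
  \<comment> \<open>Zero is a boundary, so \<open>z\<close> is nonzero. Below degree -1 only the
    zero chain exists, hence \<open>d + 1\<close> is a natural number and can serve as the
    index.\<close>
  have "0 = boundary 0" "0 \<in> simplicial_chains K (d + 1)"
    by (simp_all add: simplicial_chains_def)
  then have "z \<noteq> 0"
    using z(3) by blast
  then have "d \<ge> - 1"
    using z(1) simplicial_chains_negative[of d K] by force
  define n where "n = nat (d + 1)"
  have d: "d = int n - 1"
    using \<open>d \<ge> - 1\<close> by (simp add: n_def)
  have "c \<in> boundary ` chains_on (layer K (Suc j))"
    if "c \<in> chains_on (layer K j)" "boundary c = 0" "j \<noteq> n" for c j
  proof -
    have "int j - 1 \<noteq> d"
      using that d by auto
    then have "trivial_group (reduced_homology K (int j - 1))"
      using sph by (simp add: homology_sphere_def)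
    then show ?thesis
      using that unfolding trivial_reduced_homology_iff[OF K] simplicial_chains_eq simplicial_chains_eq_Suc
      by blast
  qed
  then have "sphere_class K n z"
    using z unfolding sphere_class_def d simplicial_chains_eq simplicial_chains_eq_Suc by blast
  then show "\<exists>n z. d = int n - 1 \<and> sphere_class K n z"
    using d by blast
next
  assume "\<exists>n z. d = int n - 1 \<and> sphere_class K n z"
  then obtain n z where d: "d = int n - 1" and z: "sphere_class K n z"
    by blast
  have "trivial_group (reduced_homology K i)" if "i \<noteq> d" for i
  proof (cases "i < - 1")
    case True
    have "0 \<in> boundary ` simplicial_chains K (i + 1)"
      by (rule image_eqI[of _ _ 0]) (simp_all add: simplicial_chains_def)
    then show ?thesis
      unfolding trivial_reduced_homology_iff[OF K] simplicial_chains_negative[OF True] by simp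
  next
    case False
    then have "i = int (nat (i + 1)) - 1"
      by simp
    then obtain j where j: "i = int j - 1"
      by blast
    then have "j \<noteq> n"
      using that d by auto
    then show ?thesis
      using z unfolding sphere_class_def trivial_reduced_homology_iff[OF K] j
        simplicial_chains_eq simplicial_chains_eq_Suc
      by blast
  qed
  moreover have "reduced_homology K d \<cong> integer_mod_group 2"
    unfolding reduced_homology_iso_iff[OF K]
    using z unfolding d simplicial_chains_eq simplicial_chains_eq_Suc sphere_class_def by blast
  ultimately show "homology_sphere K d"
    by (simp add: homology_sphere_def)
qed

lemma sphere_class_nonzero:
  assumes "sphere_class K n z"
  shows "z \<noteq> 0"
proof
  assume "z = 0"
  then have "z = boundary 0"
    by simp
  then show False
    using assms chains_on_0[of "layer K (Suc n)"] unfolding sphere_class_def by blast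
qed

section \<open>Smith theory for involutions\<close>

abbreviation part :: "nat \<Rightarrow> ('a set \<Rightarrow>\<^sub>0 bit) \<Rightarrow> 'a set \<Rightarrow>\<^sub>0 bit" where
  "part j \<equiv> restrict_chain (\<lambda>\<sigma>. card \<sigma> = j)"

text \<open>The descending filtration by the number of vertices, along which chains are cleared from
  the bottom dimension upwards.\<close>

definition card_ge :: "nat \<Rightarrow> ('a set \<Rightarrow>\<^sub>0 bit) \<Rightarrow> bool" where
  "card_ge j c \<longleftrightarrow> (\<forall>\<sigma>\<in>Poly_Mapping.keys c. j \<le> card \<sigma>)"

lemma card_ge_0 [simp]: "card_ge 0 c" "card_ge j 0"
  by (simp_all add: card_ge_def)

lemma card_ge_add: "card_ge j x \<Longrightarrow> card_ge j y \<Longrightarrow> card_ge j (x + y)"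
  by (auto simp: card_ge_def keys_add_bit)

lemma card_ge_mono: "card_ge j x \<Longrightarrow> i \<le> j \<Longrightarrow> card_ge i x"
  by (auto simp: card_ge_def)

lemma card_ge_part: "card_ge j x \<Longrightarrow> i < j \<Longrightarrow> part i x = 0"
  by (rule restrict_chain_zero) (auto simp: card_ge_def)

lemma part_chains_on [simp]: "c \<in> chains_on K \<Longrightarrow> part j c \<in> chains_on (layer K j)"
  by (auto simp: chains_on_def)

lemma part_layer: "c \<in> chains_on (layer K j) \<Longrightarrow> part i c = (if i = j then c else 0)"
  by (auto intro!: restrict_chain_zero restrict_chain_triv simp: chains_on_def subset_iff)

lemma chains_on_layerD: "c \<in> chains_on (layer K j) \<Longrightarrow> c \<in> chains_on K"
  by (auto simp: chains_on_def)

text \<open>The boundary removes exactly one vertex, so only faces with \<open>Suc j\<close>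
  vertices contribute to faces with \<open>j\<close>.\<close>

lemma part_boundary:
  assumes "simplicial_complex K" "c \<in> chains_on K"
  shows "part j (boundary c) = boundary (part (Suc j) c)"
proof -
  let ?r = "restrict_chain (\<lambda>\<sigma>. card \<sigma> \<noteq> Suc j) c"
  have fin: "finite \<sigma>" if "\<sigma> \<in> Poly_Mapping.keys c" for \<sigma>
    using assms that by (auto simp: simplicial_complex_def chains_on_def)
  have "part j (boundary c) = part j (boundary (part (Suc j) c)) + part j (boundary ?r)"
    by (metis boundary_add restrict_chain_add_compl restrict_chain_plus)
  moreover have "part j (boundary ?r) = 0"
  proof (rule restrict_chain_zero)
    fix \<tau> assume "\<tau> \<in> Poly_Mapping.keys (boundary ?r)"
    then obtain \<sigma> x where "\<sigma> \<in> Poly_Mapping.keys c" "card \<sigma> \<noteq> Suc j" "x \<in> \<sigma>" "\<tau> = \<sigma> - {x}"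
      by (auto elim!: keys_boundaryD)
    then show "card \<tau> \<noteq> j"
      using fin card_Suc_Diff1 by metis
  qed
  moreover have "boundary (part (Suc j) c) \<in> chains_on (layer K j)"
    using assms by (intro chains_on_layer_boundary part_chains_on)
  ultimately show ?thesis
    by (simp add: part_layer)
qed

text \<open>For \<open>j = 0\<close> the premise is empty, but then only the empty face can occur,
  and its augmented boundary is zero.\<close>

lemma boundary_part_eq_0:
  assumes "simplicial_complex K" "c \<in> chains_on K" "\<And>i. j = Suc i \<Longrightarrow> part i (boundary c) = 0"
  shows "boundary (part j c) = 0"
proof (cases j)
  case 0
  have "Poly_Mapping.keys (boundary (part 0 c)) = {}"
    using simplicial_complexD(1)[OF assms(1)] assms(2)
    by (intro equals0I) (auto elim!: keys_boundaryD simp: chains_on_def)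
  then have "boundary (part 0 c) = 0"
    by simp
  then show ?thesis
    by (simp add: 0)
next
  case (Suc i)
  then show ?thesis
    using assms part_boundary by metis
qed

text \<open>The component of the largest admissible size is split off, and the primitives of all
  components are added up.\<close>

lemma boundary_of_parts:
  assumes "c \<in> chains_on K" "\<And>j. part j c \<in> boundary ` chains_on K"
    and "\<And>\<sigma>. \<sigma> \<in> Poly_Mapping.keys c \<Longrightarrow> card \<sigma> < n"
  shows "c \<in> boundary ` chains_on K"
  using assms
proof (induction n arbitrary: c)
  case 0
  then have "Poly_Mapping.keys c = {}"
    by (intro equals0I) auto
  then have "c = boundary 0"
    by simp
  then show ?case
    using chains_on_0 by blast
next
  case (Suc n)
  let ?r = "restrict_chain (\<lambda>\<sigma>. card \<sigma> \<noteq> n) c"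
  have r: "c = part n c + ?r"
    by (simp add: restrict_chain_add_compl)
  have "?r \<in> boundary ` chains_on K"
  proof (rule Suc.IH)
    show "?r \<in> chains_on K"
      using Suc.prems(1) by (auto simp: chains_on_def)
    show "part j ?r \<in> boundary ` chains_on K" for j
    proof (cases "j = n")
      case True
      then have "part j ?r = boundary 0"
        by (auto intro: restrict_chain_zero)
      then show ?thesis
        using chains_on_0 by blast
    next
      case False
      then have "part j ?r = part j c"
        by (intro chain_eqI) auto
      then show ?thesis
        using Suc.prems(2) by simp
    qed
    show "card \<sigma> < n" if "\<sigma> \<in> Poly_Mapping.keys ?r" for \<sigma>
      using that Suc.prems(3)[of \<sigma>] by auto
  qed
  then obtain x y where "part n c = boundary x" "?r = boundary y" "x \<in> chains_on K" "y \<in> chains_on K"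
    using Suc.prems(2)[of n] by blast
  then have "c = boundary (x + y)" "x + y \<in> chains_on K"
    using r by simp_all
  then show ?case
    by blast
qed

text \<open>One-dimensional total homology is concentrated in one degree. Some component of
  \<open>f\<close> does not bound, and it serves as the class; comparing
  \<open>c + f = boundary b\<close> degree by degree rules out homology elsewhere.\<close>

lemma sphere_class_of_total_class:
  assumes K: "simplicial_complex K" and f: "f \<in> chains_on K" "boundary f = 0" "f \<notin> boundary ` chains_on K"
    and uniq: "\<And>g. g \<in> chains_on K \<Longrightarrow> boundary g = 0 \<Longrightarrow>
      g \<in> boundary ` chains_on K \<or> g + f \<in> boundary ` chains_on K"
  shows "\<exists>m z. sphere_class K m z"
proof -
  obtain n where n: "\<And>\<sigma>. \<sigma> \<in> Poly_Mapping.keys f \<Longrightarrow> card \<sigma> < n"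
    using finite_nat_set_iff_bounded[of "card ` Poly_Mapping.keys f"] by auto
  obtain m where m: "part m f \<notin> boundary ` chains_on K"
    using boundary_of_parts[OF f(1) _ n] f(3) by blast
  have "sphere_class K m (part m f)"
    unfolding sphere_class_def
  proof (intro conjI allI ballI impI)
    show "part m f \<in> chains_on (layer K m)"
      using f by simp
    show "boundary (part m f) = 0"
      using boundary_part_eq_0[OF K f(1)] f(2) by (simp add: restrict_chain_def)
    show "part m f \<notin> boundary ` chains_on (layer K (Suc m))"
      using m chains_on_layerD by blast
    fix j c assume c: "c \<in> chains_on (layer K j)" "boundary c = 0"
    show "c \<in> boundary ` chains_on (layer K (Suc j)) \<or>
        j = m \<and> c + part m f \<in> boundary ` chains_on (layer K (Suc j))"
      using uniq[OF chains_on_layerD[OF c(1)] c(2)]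
    proof
      assume "c \<in> boundary ` chains_on K"
      then obtain b where b: "b \<in> chains_on K" "c = boundary b"
        by blast
      then have "c = boundary (part (Suc j) b)"
        using part_layer[OF c(1), of j] part_boundary[OF K b(1), of j] by simp
      then show ?thesis
        using part_chains_on[OF b(1)] by blast
    next
      assume "c + f \<in> boundary ` chains_on K"
      then obtain b where b: "b \<in> chains_on K" "c + f = boundary b"
        by blast
      have *: "part i c + part i f = boundary (part (Suc i) b)" for i
        using part_boundary[OF K b(1), of i] by (simp flip: b(2))
      \<comment> \<open>If \<open>c\<close> lived in another degree, the component of the equation
        in degree \<open>m\<close> would exhibit \<open>part m f\<close> as a boundary.\<close>
      have "j = m"
      proof (rule ccontr)
        assume "j \<noteq> m"
        then have "part m f = boundary (part (Suc m) b)"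
          using *[of m] part_layer[OF c(1), of m] by simp
        then show False
          using m chains_on_layerD[OF part_chains_on[OF b(1)]] by blast
      qed
      moreover have "c + part m f = boundary (part (Suc j) b)"
        using *[of j] part_layer[OF c(1), of j] \<open>j = m\<close> by simp
      ultimately show ?thesis
        using part_chains_on[OF b(1)] by blast
    qed
  qed
  then show ?thesis
    by blast
qed

text \<open>By \<open>regular\<close>, invariant faces are fixed pointwise. So the faces outside the
  fixed subcomplex fall into orbits of exactly two faces, which makes \<open>1 + push\<close> exact
  on them.\<close>

locale regular_involution =
  fixes K :: "'a set set" and \<nu> :: "'a \<Rightarrow> 'a"
  assumes complex: "simplicial_complex K" and finite_K: "finite K"
    and image_face: "\<sigma> \<in> K \<Longrightarrow> \<nu> ` \<sigma> \<in> K"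
    and involution: "\<sigma> \<in> K \<Longrightarrow> x \<in> \<sigma> \<Longrightarrow> \<nu> (\<nu> x) = x"
    and regular: "\<sigma> \<in> K \<Longrightarrow> \<nu> ` \<sigma> = \<sigma> \<Longrightarrow> x \<in> \<sigma> \<Longrightarrow> \<nu> x = x"
begin

definition F :: "'a set set" where
  "F = {\<sigma> \<in> K. \<forall>x\<in>\<sigma>. \<nu> x = x}"

definition push :: "('a set \<Rightarrow>\<^sub>0 bit) \<Rightarrow> 'a set \<Rightarrow>\<^sub>0 bit" where
  "push = lin (\<lambda>\<sigma>. cell (\<nu> ` \<sigma>))"

text \<open>
  This is an ungraded differential on the chains of the whole complex. On the invariant
  subcomplex it restricts to the boundary, and it is acyclic on the quotient.
\<close>

definition D :: "('a set \<Rightarrow>\<^sub>0 bit) \<Rightarrow> 'a set \<Rightarrow>\<^sub>0 bit" where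
  "D c = boundary c + (c + push c)"

lemma F_subset: "F \<subseteq> K"
  by (auto simp: F_def)

lemma complex_F: "simplicial_complex F"
  using complex by (auto simp: simplicial_complex_def F_def)

lemma image_image_face: "\<sigma> \<in> K \<Longrightarrow> \<nu> ` \<nu> ` \<sigma> = \<sigma>"
  using involution by (force simp: image_image)

lemma inj_on_face: "\<sigma> \<in> K \<Longrightarrow> inj_on \<nu> \<sigma>"
  using involution by (intro inj_onI) metis

lemma card_image_face [simp]: "\<sigma> \<in> K \<Longrightarrow> card (\<nu> ` \<sigma>) = card \<sigma>"
  by (simp add: card_image inj_on_face)

lemma image_face_F: "\<sigma> \<in> K \<Longrightarrow> \<nu> ` \<sigma> \<in> F \<Longrightarrow> \<sigma> \<in> F"
proof -
  assume \<sigma>: "\<sigma> \<in> K" "\<nu> ` \<sigma> \<in> F"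
  then have "\<nu> ` \<nu> ` \<sigma> = \<nu> ` \<sigma>"
    by (auto simp: F_def image_image)
  then show ?thesis
    using \<sigma> image_image_face by simp
qed

lemma push_add [simp]: "push (x + y) = push x + push y" and push_0 [simp]: "push 0 = 0"
  and push_cell [simp]: "push (cell \<sigma>) = cell (\<nu> ` \<sigma>)"
  by (simp_all add: push_def)

lemma D_add [simp]: "D (x + y) = D x + D y" and D_0 [simp]: "D 0 = 0"
  by (simp_all add: D_def ac_simps)

lemma keys_push: "Poly_Mapping.keys (push c) \<subseteq> (`) \<nu> ` Poly_Mapping.keys c"
  using keys_lin[of _ c] by (force simp: push_def)

lemma push_push: "c \<in> chains_on K \<Longrightarrow> push (push c) = c"
  unfolding chains_on_def mem_Collect_eq
  by (induction c rule: chain_induct) (auto simp: image_image_face)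

lemma lookup_push:
  assumes "c \<in> chains_on K" "\<tau> \<in> K"
  shows "Poly_Mapping.lookup (push c) \<tau> = Poly_Mapping.lookup c (\<nu> ` \<tau>)"
proof -
  have "\<nu> ` \<sigma> = \<tau> \<longleftrightarrow> \<sigma> = \<nu> ` \<tau>" if "\<sigma> \<in> K" for \<sigma>
    using image_image_face that assms(2) by metis
  then have *: "Poly_Mapping.lookup (push (cell \<sigma>)) \<tau> = Poly_Mapping.lookup (cell \<sigma>) (\<nu> ` \<tau>)" if "\<sigma> \<in> K" for \<sigma>
    using that by (simp add: lookup_cell)
  from assms(1) show ?thesis
    unfolding chains_on_def mem_Collect_eq
    by (induction c rule: chain_induct) (simp_all add: lookup_add * del: push_cell)
qed

lemma chains_on_push [simp]: "c \<in> chains_on K \<Longrightarrow> push c \<in> chains_on K"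
  using keys_push[of c] image_face by (force simp: chains_on_def)

lemma card_ge_push: "c \<in> chains_on K \<Longrightarrow> card_ge j c \<Longrightarrow> card_ge j (push c)"
  using keys_push[of c] by (force simp: chains_on_def card_ge_def)

lemma push_cell_boundary:
  assumes "\<sigma> \<in> K"
  shows "push (cell_boundary \<sigma>) = cell_boundary (\<nu> ` \<sigma>)"
proof -
  have "\<nu> ` (\<sigma> - {x}) = \<nu> ` \<sigma> - {\<nu> x}" if "x \<in> \<sigma>" for x
    using inj_on_image_set_diff[OF inj_on_face[OF assms], of \<sigma> "{x}"] that by auto
  then show ?thesis
    by (simp add: push_def cell_boundary_def sum.reindex[OF inj_on_face[OF assms]])
qed

lemma push_boundary: "c \<in> chains_on K \<Longrightarrow> push (boundary c) = boundary (push c)"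
  unfolding chains_on_def mem_Collect_eq
  by (induction c rule: chain_induct) (auto simp: push_cell_boundary)

lemma chains_on_D [simp]: "c \<in> chains_on K \<Longrightarrow> D c \<in> chains_on K"
  by (simp add: D_def chains_on_boundary[OF complex])

text \<open>\<open>boundary\<close> and \<open>1 + push\<close> commute, and both square to zero:
  the latter because \<open>push\<close> is an involution and the characteristic is two.\<close>

lemma D_D: "c \<in> chains_on K \<Longrightarrow> D (D c) = 0"
  by (simp add: D_def push_boundary push_push ac_simps)

lemma push_F: "c \<in> chains_on F \<Longrightarrow> push c = c"
proof -
  have *: "\<nu> ` \<sigma> = \<sigma>" if "\<sigma> \<in> F" for \<sigma>
    using that by (force simp: F_def)
  assume "c \<in> chains_on F"
  then have "Poly_Mapping.keys c \<subseteq> F"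
    by (simp add: chains_on_def)
  then show ?thesis
    by (induction c rule: chain_induct) (auto simp: *)
qed

lemma D_F: "c \<in> chains_on F \<Longrightarrow> D c = boundary c"
  by (simp add: D_def push_F)

text \<open>The support of \<open>w\<close> splits into two-element orbits, and \<open>c\<close>
  collects one face from each. This is the exactness of \<open>1 + push\<close> away from
  \<open>F\<close>.\<close>

lemma invariant_free_chain:
  assumes "w \<in> chains_on K" "Poly_Mapping.keys w \<inter> F = {}" "push w = w"
  shows "\<exists>c. Poly_Mapping.keys c \<subseteq> Poly_Mapping.keys w \<and> w = c + push c"
  using assms
proof (induction "card (Poly_Mapping.keys w)" arbitrary: w rule: less_induct)
  case less
  show ?case
  proof (cases "w = 0")
    case True
    then show ?thesis
      by (intro exI[of _ 0]) simp
  next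
    case False
    then obtain \<sigma> where \<sigma>: "\<sigma> \<in> Poly_Mapping.keys w"
      by fastforce
    then have \<sigma>K: "\<sigma> \<in> K" "\<sigma> \<notin> F"
      using less.prems by (auto simp: chains_on_def)
    then have ne: "\<nu> ` \<sigma> \<noteq> \<sigma>"
      using regular unfolding F_def by blast
    have \<sigma>': "\<nu> ` \<sigma> \<in> Poly_Mapping.keys w"
      using lookup_push[OF less.prems(1) \<sigma>K(1)] \<sigma> less.prems(3) by (simp add: in_keys_iff)
    define w' where "w' = w + (cell \<sigma> + cell (\<nu> ` \<sigma>))"
    have keys: "Poly_Mapping.keys w' = Poly_Mapping.keys w - {\<sigma>, \<nu> ` \<sigma>}"
      using \<sigma> \<sigma>' ne by (auto simp: w'_def keys_add_bit)
    have "push w' = w'"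
      using less.prems(3) by (simp add: w'_def image_image_face[OF \<sigma>K(1)] ac_simps)
    moreover have "card (Poly_Mapping.keys w') < card (Poly_Mapping.keys w)"
      using \<sigma> unfolding keys by (intro psubset_card_mono) auto
    moreover have "w' \<in> chains_on K" "Poly_Mapping.keys w' \<inter> F = {}"
      using less.prems keys by (auto simp: chains_on_def)
    ultimately obtain c where c: "Poly_Mapping.keys c \<subseteq> Poly_Mapping.keys w'" "w' = c + push c"
      using less.hyps by blast
    have "w = w' + (cell \<sigma> + cell (\<nu> ` \<sigma>))"
      by (simp add: w'_def add.assoc)
    then have "w = (c + cell \<sigma>) + push (c + cell \<sigma>)"
      unfolding c(2) by (simp add: ac_simps)
    moreover have "Poly_Mapping.keys (c + cell \<sigma>) \<subseteq> Poly_Mapping.keys w"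
      using keys_add[of c "cell \<sigma>"] c(1) keys \<sigma> by auto
    ultimately show ?thesis
      by blast
  qed
qed

text \<open>Downward clearing: the faces of \<open>b\<close> outside \<open>F\<close> of the largest
  size form an invariant chain \<open>w = c + push c\<close>. Adding \<open>D c\<close> cancels
  \<open>w\<close> and introduces only \<open>boundary c\<close>, whose faces are smaller.\<close>

lemma deform_into_F:
  assumes "b \<in> chains_on K" "D b \<in> chains_on F"
  shows "\<exists>c \<in> chains_on K. b + D c \<in> chains_on F"
proof -
  have "\<exists>c \<in> chains_on K. b + D c \<in> chains_on F"
    if "b \<in> chains_on K" "D b \<in> chains_on F" "\<And>\<sigma>. \<sigma> \<in> Poly_Mapping.keys b \<Longrightarrow> \<sigma> \<notin> F \<Longrightarrow> card \<sigma> < j"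
    for b j
    using that
  proof (induction j arbitrary: b)
    case 0
    then have "b + D 0 \<in> chains_on F"
      by (auto simp: chains_on_def)
    then show ?case
      by (rule bexI) simp
  next
    case (Suc j)
    define w where "w = restrict_chain (\<lambda>\<sigma>. \<sigma> \<notin> F \<and> card \<sigma> = j) b"
    have w: "w \<in> chains_on K" "Poly_Mapping.keys w \<inter> F = {}"
      using Suc.prems(1) by (auto simp: w_def chains_on_def)
    have closed: "\<nu> ` \<sigma> \<in> Poly_Mapping.keys w" if \<sigma>: "\<sigma> \<in> Poly_Mapping.keys w" for \<sigma>
    proof -
      have \<sigma>b: "\<sigma> \<in> Poly_Mapping.keys b" "\<sigma> \<notin> F" "card \<sigma> = j" "\<sigma> \<in> K"
        using \<sigma> Suc.prems(1) by (auto simp: w_def chains_on_def)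
      \<comment> \<open>A coface of \<open>\<sigma>\<close> in \<open>b\<close> would lie outside
        \<open>F\<close>, because \<open>F\<close> is closed under taking faces, and would have more
        than \<open>j\<close> vertices.\<close>
      have "\<sigma> \<notin> Poly_Mapping.keys (boundary b)"
      proof
        assume "\<sigma> \<in> Poly_Mapping.keys (boundary b)"
        then obtain \<sigma>' x where \<sigma>': "\<sigma>' \<in> Poly_Mapping.keys b" "finite \<sigma>'" "x \<in> \<sigma>'" "\<sigma> = \<sigma>' - {x}"
          by (rule keys_boundaryD)
        have "\<sigma>' \<notin> F"
          using \<sigma>b(2) \<sigma>'(4) simplicial_complexD(2)[OF complex_F, of \<sigma>' \<sigma>] by blast
        then have "card \<sigma>' < Suc j"
          using Suc.prems(3) \<sigma>' by blast
        then show False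
          using card_Suc_Diff1[OF \<sigma>'(2,3)] \<sigma>'(4) \<sigma>b(3) by simp
      qed
      moreover have "\<sigma> \<notin> Poly_Mapping.keys (D b)"
        using Suc.prems(2) \<sigma>b(2) by (auto simp: chains_on_def)
      \<comment> \<open>At \<open>\<sigma>\<close> both \<open>D b\<close> and
        \<open>boundary b\<close> vanish, so the coefficients of \<open>b\<close> and
        \<open>push b\<close> there agree.\<close>
      ultimately have "\<nu> ` \<sigma> \<in> Poly_Mapping.keys b"
        using \<sigma>b(1) by (simp add: in_keys_iff D_def lookup_add lookup_push[OF Suc.prems(1) \<sigma>b(4)])
      then show ?thesis
        using \<sigma>b image_face_F by (auto simp: w_def)
    qed
    have "push w = w"
    proof (rule chain_eqI)
      have "\<sigma> \<in> Poly_Mapping.keys (push w) \<longleftrightarrow> \<sigma> \<in> Poly_Mapping.keys w" if "\<sigma> \<in> K" for \<sigma>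
        using closed[of \<sigma>] closed[of "\<nu> ` \<sigma>"] image_image_face[OF that] lookup_push[OF w(1) that]
        by (metis in_keys_iff)
      then show "Poly_Mapping.keys (push w) = Poly_Mapping.keys w"
        using w(1) chains_on_push[OF w(1)] unfolding chains_on_def by blast
    qed
    then obtain c where c: "Poly_Mapping.keys c \<subseteq> Poly_Mapping.keys w" "w = c + push c"
      using invariant_free_chain[OF w] by blast
    have cK: "c \<in> chains_on K"
      using c w by (auto simp: chains_on_def)
    have bc: "b + D c = (b + w) + boundary c"
      by (simp add: D_def c(2)[symmetric] ac_simps)
    have "card \<sigma> < j" if "\<sigma> \<in> Poly_Mapping.keys (b + D c)" "\<sigma> \<notin> F" for \<sigma>
    proof -
      have "\<sigma> \<in> Poly_Mapping.keys (b + w) \<or> \<sigma> \<in> Poly_Mapping.keys (boundary c)"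
        using that(1) unfolding bc by (auto simp: keys_add_bit)
      then show ?thesis
      proof
        assume "\<sigma> \<in> Poly_Mapping.keys (b + w)"
        then have "\<sigma> \<in> Poly_Mapping.keys b" "card \<sigma> \<noteq> j"
          using that(2) by (auto simp: keys_add_bit w_def)
        then show ?thesis
          using Suc.prems(3)[of \<sigma>] that(2) by simp
      next
        assume "\<sigma> \<in> Poly_Mapping.keys (boundary c)"
        then obtain \<sigma>' x where \<sigma>': "\<sigma>' \<in> Poly_Mapping.keys c" "finite \<sigma>'" "x \<in> \<sigma>'" "\<sigma> = \<sigma>' - {x}"
          by (rule keys_boundaryD)
        then have "card \<sigma>' = j"
          using c(1) by (auto simp: w_def)
        then show ?thesis
          using card_Diff1_less[OF \<sigma>'(2,3)] \<sigma>'(4) by simp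
      qed
    qed
    moreover have "b + D c \<in> chains_on K" "D (b + D c) \<in> chains_on F"
      using cK Suc.prems D_D by auto
    ultimately obtain c' where "c' \<in> chains_on K" "b + D c + D c' \<in> chains_on F"
      using Suc.IH by blast
    then show ?case
      using cK by (intro bexI[of _ "c + c'"]) (auto simp: add.assoc)
  qed
  moreover have "\<exists>j. \<forall>\<sigma>\<in>Poly_Mapping.keys b. card \<sigma> < j"
    using finite_nat_set_iff_bounded[of "card ` Poly_Mapping.keys b"] by auto
  ultimately show ?thesis
    using assms by meson
qed

text \<open>In \<open>boundary b = D b + b + push b\<close> every term on the right starts at
  \<open>j\<close> vertices, whereas the boundary of the lowest component has
  \<open>j - 1\<close>.\<close>

lemma boundary_lowest_part:
  assumes "b \<in> chains_on K" "card_ge j b" "card_ge j (D b)"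
  shows "boundary (part j b) = 0"
proof (rule boundary_part_eq_0[OF complex assms(1)])
  fix i assume i: "j = Suc i"
  have "boundary b = D b + (b + push b)"
    by (simp add: D_def ac_simps)
  then show "part i (boundary b) = 0"
    using card_ge_part[OF assms(2)] card_ge_part[OF assms(3)]
      card_ge_part[OF card_ge_push[OF assms(1,2)]] i by simp
qed

text \<open>The summand \<open>boundary c\<close> of \<open>D c\<close> cancels the lowest component
  of \<open>b\<close>, and the remaining \<open>c + push c\<close> has \<open>Suc j\<close> vertices
  per face.\<close>

lemma card_ge_Suc_add_D:
  assumes "b \<in> chains_on K" "card_ge j b" "c \<in> chains_on (layer K (Suc j))" "part j b = boundary c"
  shows "card_ge (Suc j) (b + D c)"
proof -
  have keys: "Poly_Mapping.keys (b + boundary c) = {\<sigma> \<in> Poly_Mapping.keys b. card \<sigma> \<noteq> j}"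
    unfolding assms(4)[symmetric] keys_add_bit keys_restrict_chain by auto
  have "card_ge (Suc j) (b + boundary c)"
    unfolding card_ge_def keys
  proof
    fix \<sigma> assume "\<sigma> \<in> {\<sigma> \<in> Poly_Mapping.keys b. card \<sigma> \<noteq> j}"
    then have "j \<le> card \<sigma>" "card \<sigma> \<noteq> j"
      using assms(2) by (auto simp: card_ge_def)
    then show "Suc j \<le> card \<sigma>"
      by simp
  qed
  moreover have "card_ge (Suc j) c"
    using assms(3) by (auto simp: card_ge_def chains_on_def)
  then have "card_ge (Suc j) (c + push c)"
    using card_ge_push[OF chains_on_layerD[OF assms(3)]] by (intro card_ge_add)
  ultimately have "card_ge (Suc j) ((b + boundary c) + (c + push c))"
    by (rule card_ge_add)
  then show ?thesis
    by (simp add: D_def add.assoc)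
qed

section \<open>Homology of \<open>D\<close> when the complex is a homology sphere\<close>

context
  fixes n z
  assumes z: "sphere_class K n z"
begin

lemma part_cases:
  assumes "b \<in> chains_on K" "card_ge j b" "card_ge j (D b)"
  obtains c where "c \<in> chains_on (layer K (Suc j))" "part j b = boundary c"
  | c where "c \<in> chains_on (layer K (Suc j))" "j = n" "part j b + z = boundary c"
proof -
  have "part j b \<in> chains_on (layer K j)" "boundary (part j b) = 0"
    using assms boundary_lowest_part by auto
  then have "part j b \<in> boundary ` chains_on (layer K (Suc j)) \<or>
      (j = n \<and> part j b + z \<in> boundary ` chains_on (layer K (Suc j)))"
    using z unfolding sphere_class_def by (elim conjE) (drule spec, drule bspec, assumption, blast)
  then show thesis
    by (elim disjE conjE imageE) (rule that, assumption+)+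
qed

text \<open>Above the sphere's degree every lowest component bounds and can be cleared. The sizes of
  faces are bounded by \<open>M\<close>, so clearing upwards stops, which is the induction on
  \<open>M - j\<close>.\<close>

lemma D_exact_above:
  assumes "e \<in> chains_on K" "D e = 0" "card_ge j e" "n < j"
  shows "\<exists>c \<in> chains_on K. card_ge (Suc j) c \<and> e = D c"
proof -
  obtain M where M: "\<And>\<sigma>. \<sigma> \<in> K \<Longrightarrow> card \<sigma> < M"
    using finite_nat_set_iff_bounded[of "card ` K"] finite_K by auto
  show ?thesis
    using assms
  proof (induction "M - j" arbitrary: j e)
    case 0
    have "Poly_Mapping.keys e = {}"
    proof (rule equals0I)
      fix \<sigma> assume "\<sigma> \<in> Poly_Mapping.keys e"
      then have "card \<sigma> < M" "j \<le> card \<sigma>"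
        using 0 M by (auto simp: card_ge_def chains_on_def)
      then show False
        using 0 by simp
    qed
    then show ?case
      by (intro bexI[of _ 0]) auto
  next
    case (Suc k)
    have "card_ge j (D e)"
      using Suc.prems(2) by simp
    with Suc.prems(1,3) obtain c where c: "c \<in> chains_on (layer K (Suc j))" "part j e = boundary c"
      by (rule part_cases) (use Suc.prems(4) in auto)
    have cK: "c \<in> chains_on K"
      using c(1) by (rule chains_on_layerD)
    have "\<exists>c' \<in> chains_on K. card_ge (Suc (Suc j)) c' \<and> e + D c = D c'"
    proof (rule Suc.hyps(1))
      show "k = M - Suc j" "n < Suc j"
        using Suc.hyps(2) Suc.prems(4) by simp_all
      show "e + D c \<in> chains_on K" "D (e + D c) = 0"
        using Suc.prems(1,2) cK by (simp_all add: D_D)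
      show "card_ge (Suc j) (e + D c)"
        using Suc.prems(1,3) c by (rule card_ge_Suc_add_D)
    qed
    then obtain c' where c': "c' \<in> chains_on K" "card_ge (Suc (Suc j)) c'" "e + D c = D c'"
      by blast
    have "e = D (c + c')"
      by (simp flip: c'(3))
    moreover have "card_ge (Suc j) (c + c')"
      using c(1) c'(2) by (intro card_ge_add) (auto simp: card_ge_def chains_on_def)
    ultimately show ?case
      using c'(1) cK by (intro bexI[of _ "c + c'"]) simp_all
  qed
qed

text \<open>The cycle \<open>z\<close> need not be closed for \<open>D\<close>; the error
  \<open>z + push z\<close> is corrected by chains in higher dimensions only, so the lowest
  component stays \<open>z\<close>.\<close>

lemma lift_sphere_class:
  obtains \<zeta> where "\<zeta> \<in> chains_on K" "D \<zeta> = 0" "card_ge n \<zeta>" "part n \<zeta> = z"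
proof -
  have zn: "z \<in> chains_on (layer K n)" "boundary z = 0" "z \<notin> boundary ` chains_on (layer K (Suc n))"
    using z by (auto simp: sphere_class_def)
  have zK: "z \<in> chains_on K"
    using zn(1) by (rule chains_on_layerD)
  have push_layer: "push c \<in> chains_on (layer K j)" if "c \<in> chains_on (layer K j)" for c j
    using that keys_push[of c] image_face by (force simp: chains_on_def)
  \<comment> \<open>\<open>push\<close> would carry a primitive of \<open>push z\<close> to a
    primitive of \<open>z\<close>. So \<open>push z\<close> does not bound, and having only one
    nonzero class makes it homologous to \<open>z\<close>.\<close>
  have "push z \<notin> boundary ` chains_on (layer K (Suc n))"
  proof
    assume "push z \<in> boundary ` chains_on (layer K (Suc n))"
    then obtain y where y: "y \<in> chains_on (layer K (Suc n))" "push z = boundary y"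
      by blast
    then have "z = boundary (push y)"
      using push_push[OF zK] push_boundary[OF chains_on_layerD[OF y(1)]] by simp
    then show False
      using zn(3) push_layer[OF y(1)] by blast
  qed
  moreover have "boundary (push z) = 0"
    using push_boundary[OF zK] zn(2) by simp
  ultimately have "push z + z \<in> boundary ` chains_on (layer K (Suc n))"
    using z push_layer[OF zn(1)] unfolding sphere_class_def
    by (elim conjE) (drule spec, drule bspec, assumption, blast)
  then obtain y where y: "y \<in> chains_on (layer K (Suc n))" "push z + z = boundary y"
    by blast
  have yK: "y \<in> chains_on K"
    using y(1) by (rule chains_on_layerD)
  \<comment> \<open>\<open>boundary y\<close> cancels \<open>z + push z\<close>; what remains lies
    one dimension above \<open>z\<close>, where \<open>D\<close> is exact.\<close>
  have Dzy: "D (z + y) = y + push y"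
    by (simp add: D_def zn(2) y(2)[symmetric] ac_simps)
  have "y + push y \<in> chains_on (layer K (Suc n))"
    using y(1) push_layer by simp
  moreover have "D (y + push y) = 0"
    using D_D[of "z + y"] zK yK unfolding Dzy by simp
  ultimately have "\<exists>c \<in> chains_on K. card_ge (Suc (Suc n)) c \<and> y + push y = D c"
    by (intro D_exact_above) (auto simp: card_ge_def chains_on_def subset_iff)
  then obtain c where c: "c \<in> chains_on K" "card_ge (Suc (Suc n)) c" "y + push y = D c"
    by blast
  show thesis
  proof (rule that[of "z + y + c"])
    show "z + y + c \<in> chains_on K"
      using zK yK c by simp
    show "D (z + y + c) = 0"
      using Dzy c(3) by (simp only: D_add[of "z + y" c]) simp
    show "card_ge n (z + y + c)"
      using zn(1) y(1) card_ge_mono[OF c(2), of n]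
      by (intro card_ge_add) (auto simp: card_ge_def chains_on_def subset_iff)
    show "part n (z + y + c) = z"
      using part_layer[OF zn(1), of n] part_layer[OF y(1), of n] card_ge_part[OF c(2), of n] by simp
  qed
qed

text \<open>The lift \<open>\<zeta>\<close> generates the homology of \<open>D\<close>
  (\<open>gen\<close>) and does not bound (\<open>nontriv\<close>). \<open>deform_into_F\<close>
  transports both facts to \<open>F\<close>, where \<open>D\<close> is the boundary.\<close>

lemma smith: "\<exists>m w. sphere_class F m w"
proof -
  obtain \<zeta> where \<zeta>: "\<zeta> \<in> chains_on K" "D \<zeta> = 0" "card_ge n \<zeta>" "part n \<zeta> = z"
    by (rule lift_sphere_class)
  have zn: "z \<in> chains_on (layer K n)" "boundary z = 0" "z \<notin> boundary ` chains_on (layer K (Suc n))"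
    using z by (auto simp: sphere_class_def)
  obtain M where M: "\<And>\<sigma>. \<sigma> \<in> K \<Longrightarrow> card \<sigma> < M"
    using finite_nat_set_iff_bounded[of "card ` K"] finite_K by auto
  \<comment> \<open>Clearing upwards again: a lowest component that bounds is removed by some
    \<open>D c\<close>. One homologous to \<open>z\<close> occurs only at \<open>j = n\<close>, and
    adding \<open>\<zeta>\<close> first makes it bound.\<close>
  have gen: "\<exists>c \<in> chains_on K. e = D c \<or> e + \<zeta> = D c" if "e \<in> chains_on K" "D e = 0" "card_ge j e" for e j
    using that
  proof (induction "M - j" arbitrary: j e)
    case 0
    have "Poly_Mapping.keys e = {}"
    proof (rule equals0I)
      fix \<sigma> assume "\<sigma> \<in> Poly_Mapping.keys e"
      then have "card \<sigma> < M" "j \<le> card \<sigma>"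
        using 0 M by (auto simp: card_ge_def chains_on_def)
      then show False
        using 0 by simp
    qed
    then show ?case
      by (intro bexI[of _ 0]) auto
  next
    case (Suc k)
    have De: "card_ge j (D e)"
      using Suc.prems(2) by simp
    from Suc.prems(1,3) De show ?case
    proof (cases rule: part_cases)
      case (1 c)
      have cK: "c \<in> chains_on K"
        using 1(1) by (rule chains_on_layerD)
      have "\<exists>c' \<in> chains_on K. e + D c = D c' \<or> e + D c + \<zeta> = D c'"
      proof (rule Suc.hyps(1))
        show "k = M - Suc j"
          using Suc.hyps(2) by simp
        show "e + D c \<in> chains_on K" "D (e + D c) = 0"
          using Suc.prems(1,2) cK by (simp_all add: D_D)
        show "card_ge (Suc j) (e + D c)"
          using Suc.prems(1,3) 1 by (rule card_ge_Suc_add_D)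
      qed
      then obtain c' where c': "c' \<in> chains_on K" "e + D c = D c' \<or> e + D c + \<zeta> = D c'"
        by blast
      have "e = D (c + c') \<or> e + \<zeta> = D (c + c')"
        using c'(2) by (auto simp: bit_chain_add_eq_iff ac_simps)
      then show ?thesis
        using c'(1) cK by (intro bexI[of _ "c + c'"]) simp_all
    next
      case (2 c)
      have cK: "c \<in> chains_on K"
        using 2(1) by (rule chains_on_layerD)
      have "card_ge (Suc j) (e + \<zeta> + D c)"
        using Suc.prems \<zeta> 2 by (intro card_ge_Suc_add_D) (auto intro: card_ge_add)
      moreover have "k = M - Suc j"
        using Suc.hyps(2) by simp
      moreover have "e + \<zeta> + D c \<in> chains_on K" "D (e + \<zeta> + D c) = 0"
        using Suc.prems(1,2) \<zeta> cK by (simp_all add: D_D)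
      ultimately have "\<exists>c' \<in> chains_on K. e + \<zeta> + D c = D c' \<or> e + \<zeta> + D c + \<zeta> = D c'"
        by (intro Suc.hyps(1))
      then obtain c' where c': "c' \<in> chains_on K" "e + \<zeta> + D c = D c' \<or> e + \<zeta> + D c + \<zeta> = D c'"
        by blast
      have "e = D (c + c') \<or> e + \<zeta> = D (c + c')"
        using c'(2) by (auto simp: bit_chain_add_eq_iff ac_simps)
      then show ?thesis
        using c'(1) cK by (intro bexI[of _ "c + c'"]) simp_all
    qed
  qed
  \<comment> \<open>A primitive of \<open>\<zeta>\<close> can be moved above \<open>n\<close>: the
    corrections \<open>D c\<close> and \<open>\<zeta>\<close> are closed for \<open>D\<close>, so
    \<open>D b\<close> is unchanged. The bound on \<open>j\<close> keeps \<open>\<zeta>\<close>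
    inside the filtration step being cleared.\<close>
  have raise: "\<exists>b \<in> chains_on K. D b = \<zeta> \<and> card_ge j b" if "b \<in> chains_on K" "D b = \<zeta>" "j \<le> Suc n" for b j
    using that
  proof (induction j)
    case (Suc j)
    then obtain b where b: "b \<in> chains_on K" "D b = \<zeta>" "card_ge j b"
      by auto
    have "card_ge j (D b)"
      using b(2) \<zeta>(3) Suc.prems(3) card_ge_mono by auto
    with b(1,3) show ?case
    proof (cases rule: part_cases)
      case (1 c)
      have cK: "c \<in> chains_on K"
        using 1(1) by (rule chains_on_layerD)
      show ?thesis
        using b cK D_D card_ge_Suc_add_D[OF b(1,3) 1] by (intro bexI[of _ "b + D c"]) auto
    next
      case (2 c)
      have cK: "c \<in> chains_on K"
        using 2(1) by (rule chains_on_layerD)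
      have "card_ge (Suc j) (b + \<zeta> + D c)"
        using b \<zeta> 2 by (intro card_ge_Suc_add_D) (auto intro: card_ge_add)
      then show ?thesis
        using b cK D_D \<zeta> by (intro bexI[of _ "b + \<zeta> + D c"]) auto
    qed
  qed auto
  \<comment> \<open>If \<open>b\<close> starts above \<open>n\<close>, then in degree
    \<open>n\<close> the equation \<open>D b = \<zeta>\<close> reduces to \<open>z\<close> being a
    boundary.\<close>
  have low: False if b: "b \<in> chains_on K" "D b = \<zeta>" "card_ge (Suc n) b" for b
  proof -
    have "boundary b = \<zeta> + (b + push b)"
      by (simp add: b(2)[symmetric] D_def ac_simps)
    then have "part n (boundary b) = z"
      using \<zeta>(4) card_ge_part[OF b(3)] card_ge_part[OF card_ge_push[OF b(1,3)]] by simp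
    then have "z = boundary (part (Suc n) b)"
      using part_boundary[OF complex b(1)] by simp
    then show False
      using zn(3) part_chains_on[OF b(1)] by blast
  qed
  have nontriv: "\<zeta> \<noteq> D b" if b: "b \<in> chains_on K" for b
  proof
    assume "\<zeta> = D b"
    then obtain b' where "b' \<in> chains_on K" "D b' = \<zeta>" "card_ge (Suc n) b'"
      using raise[OF b, of "Suc n"] by auto
    then show False
      by (rule low)
  qed
  obtain c where c: "c \<in> chains_on K" "\<zeta> + D c \<in> chains_on F"
    using deform_into_F[OF \<zeta>(1)] \<zeta>(2) by auto
  let ?f = "\<zeta> + D c"
  have FK: "x \<in> chains_on K" if "x \<in> chains_on F" for x
    using that F_subset by (rule chains_on_mono)
  show ?thesis
  proof (rule sphere_class_of_total_class[OF complex_F c(2)])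
    show "boundary ?f = 0"
      using D_F[OF c(2)] D_D[OF c(1)] \<zeta>(2) by simp
    show "?f \<notin> boundary ` chains_on F"
    proof
      assume "?f \<in> boundary ` chains_on F"
      then obtain h where h: "h \<in> chains_on F" "?f = D h"
        using D_F by force
      then have "\<zeta> = D (h + c)"
        by (simp add: bit_chain_add_eq_iff ac_simps)
      then show False
        using nontriv[of "h + c"] h(1) c(1) FK by simp
    qed
    fix g assume g: "g \<in> chains_on F" "boundary g = 0"
    \<comment> \<open>A chain on \<open>F\<close> bounding for \<open>D\<close> in \<open>K\<close>
      already bounds in \<open>F\<close>: its primitive is moved into \<open>F\<close> by a
      \<open>D\<close>-boundary, which does not change its image under \<open>D\<close>.\<close>
    have bd: "x \<in> boundary ` chains_on F" if "x \<in> chains_on F" "x = D b" "b \<in> chains_on K" for x b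
    proof -
      obtain c' where c': "c' \<in> chains_on K" "b + D c' \<in> chains_on F"
        using deform_into_F[OF \<open>b \<in> chains_on K\<close>] \<open>x \<in> _\<close> \<open>x = D b\<close> by auto
      then have "boundary (b + D c') = D (b + D c')"
        by (simp only: D_F)
      then have "x = boundary (b + D c')"
        using D_D[OF c'(1)] \<open>x = D b\<close> by simp
      then show ?thesis
        using c' by blast
    qed
    have "\<exists>b \<in> chains_on K. g = D b \<or> g + \<zeta> = D b"
      by (rule gen[of g 0]) (use g FK D_F[OF g(1)] in simp_all)
    then obtain b where b: "b \<in> chains_on K" "g = D b \<or> g + \<zeta> = D b"
      by blast
    from b(2) show "g \<in> boundary ` chains_on F \<or> g + ?f \<in> boundary ` chains_on F"
    proof
      assume "g + \<zeta> = D b"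
      then have "g + ?f = D (b + c)"
        by (simp flip: add.assoc)
      then show ?thesis
        using bd[OF chains_on_add[OF g(1) c(2)] _ chains_on_add[OF b(1) c(1)]] by blast
    next
      assume "g = D b"
      then show ?thesis
        using bd[OF g(1) _ b(1)] by simp
    qed
  qed
qed

end

end

section \<open>Posets whose open intervals are homology spheres\<close>

lemma keys_sum_cells:
  assumes "finite S"
  shows "Poly_Mapping.keys (sum cell S) = S"
proof -
  have "Poly_Mapping.lookup (sum cell S) k = (if k \<in> S then 1 else 0)" for k
    using assms by (simp add: lookup_sum lookup_cell)
  then show ?thesis
    by (auto simp: in_keys_iff split: if_splits)
qed

lemma simplicial_complex_order_complex: "simplicial_complex (order_complex A r)"
  by (auto simp: simplicial_complex_def order_complex_def Chains_def intro: finite_subset)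

text \<open>\<open>N p q\<close> is the dimension of the sphere plus one. Gradedness is still to be
  derived, so dimensions are recorded for each pair of end points.\<close>

locale spherical_poset =
  fixes P :: "'a set" and r :: "'a rel" and N :: "'a \<Rightarrow> 'a \<Rightarrow> nat"
  assumes finite_P: "finite P" and partial_order: "partial_order_on P r"
    and spherical: "(p, q) \<in> r \<Longrightarrow> p \<noteq> q \<Longrightarrow>
      \<exists>z. sphere_class (order_complex (open_interval r p q) r) (N p q) z"
begin

definition less :: "'a \<Rightarrow> 'a \<Rightarrow> bool"  (infix "\<prec>" 50) where
  "x \<prec> y \<longleftrightarrow> (x, y) \<in> r \<and> x \<noteq> y"

abbreviation \<Delta> :: "'a \<Rightarrow> 'a \<Rightarrow> 'a set set" where
  "\<Delta> p q \<equiv> order_complex (open_interval r p q) r"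

abbreviation iv :: "'a \<Rightarrow> 'a \<Rightarrow> 'a set" where
  "iv p q \<equiv> open_interval r p q"

text \<open>The dimension plus two, which is the value that the rank difference of \<open>p\<close>
  and \<open>q\<close> must have.\<close>

definition R :: "'a \<Rightarrow> 'a \<Rightarrow> nat" where
  "R p q = Suc (N p q)"

lemma less_in_P: "x \<prec> y \<Longrightarrow> x \<in> P" "x \<prec> y \<Longrightarrow> y \<in> P"
  using partial_order by (auto simp: less_def partial_order_on_def preorder_on_def)

lemma less_irrefl [simp]: "\<not> x \<prec> x"
  by (simp add: less_def)

lemma less_antisym: "x \<prec> y \<Longrightarrow> y \<prec> x \<Longrightarrow> False"
  using partial_order by (auto simp: less_def partial_order_on_def dest: antisymD)

lemma less_trans: "x \<prec> y \<Longrightarrow> y \<prec> z \<Longrightarrow> x \<prec> z"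
  using partial_order less_antisym unfolding less_def partial_order_on_def preorder_on_def
  by (metis transD)

lemma iv_iff: "x \<in> iv p q \<longleftrightarrow> p \<prec> x \<and> x \<prec> q"
  by (auto simp: open_interval_def less_def)

lemma face_iff:
  "\<sigma> \<in> \<Delta> p q \<longleftrightarrow> finite \<sigma> \<and> \<sigma> \<subseteq> iv p q \<and> (\<forall>x\<in>\<sigma>. \<forall>y\<in>\<sigma>. x = y \<or> x \<prec> y \<or> y \<prec> x)"
proof -
  have "(x, x) \<in> r" if "\<sigma> \<subseteq> iv p q" "x \<in> \<sigma>" for x
    using that partial_order less_in_P(2)[of p x]
    by (auto simp: iv_iff partial_order_on_def preorder_on_def refl_on_def)
  then show ?thesis
    by (auto simp: order_complex_def Chains_def less_def) metis
qed

lemma finite_iv: "finite (iv p q)"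
  by (rule finite_subset[OF _ finite_P]) (auto simp: iv_iff less_in_P)

lemma finite_\<Delta>: "finite (\<Delta> p q)"
  by (rule finite_subset[of _ "Pow (iv p q)"]) (auto simp: face_iff finite_iv)

lemma sphere_class_exists:
  assumes "p \<prec> q"
  obtains z where "sphere_class (\<Delta> p q) (N p q) z"
  using assms spherical unfolding less_def by blast

lemma face_exists:
  assumes "p \<prec> q"
  obtains \<sigma> where "\<sigma> \<in> \<Delta> p q" "card \<sigma> = N p q"
proof -
  obtain z where z: "sphere_class (\<Delta> p q) (N p q) z"
    using assms by (rule sphere_class_exists)
  then have "Poly_Mapping.keys z \<noteq> {}"
    using sphere_class_nonzero[OF z] by simp
  then obtain \<sigma> where "\<sigma> \<in> Poly_Mapping.keys z"
    by blast
  then show thesis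
    using z that by (auto simp: sphere_class_def chains_on_def)
qed

text \<open>Homology lives in a single degree, so one nonbounding cycle determines the
  dimension.\<close>

lemma sphere_class_degree:
  assumes "p \<prec> q" "c \<in> chains_on (layer (\<Delta> p q) j)" "boundary c = 0"
    and "c \<notin> boundary ` chains_on (layer (\<Delta> p q) (Suc j))"
  shows "N p q = j"
proof -
  obtain z where z: "sphere_class (\<Delta> p q) (N p q) z"
    using assms(1) by (rule sphere_class_exists)
  then have "\<forall>c \<in> chains_on (layer (\<Delta> p q) j). boundary c = 0 \<longrightarrow>
      c \<in> boundary ` chains_on (layer (\<Delta> p q) (Suc j)) \<or> j = N p q"
    unfolding sphere_class_def by blast
  then show ?thesis
    using assms by blast
qed

lemma N_eq_0: "p \<prec> q \<Longrightarrow> iv p q = {} \<Longrightarrow> N p q = 0"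
proof -
  assume "p \<prec> q" and empty: "iv p q = {}"
  from \<open>p \<prec> q\<close> obtain \<sigma> where \<sigma>: "\<sigma> \<in> \<Delta> p q" "card \<sigma> = N p q"
    by (rule face_exists)
  then have "\<sigma> = {}"
    using empty unfolding face_iff by blast
  then show ?thesis
    using \<sigma>(2) by simp
qed

lemma iv_subset:
  assumes "p = u \<or> p \<prec> u" "v = q \<or> v \<prec> q"
  shows "iv u v \<subseteq> iv p q"
  using assms less_trans by (auto simp: iv_iff)

text \<open>An end point that was moved lies in the larger open interval but not in the smaller one.
  This strictness drives the induction on the size of intervals.\<close>

lemma card_iv_less:
  assumes "p = u \<or> p \<prec> u" "v = q \<or> v \<prec> q" "u \<prec> v" "u \<noteq> p \<or> v \<noteq> q"
  shows "card (iv u v) < card (iv p q)"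
proof (rule psubset_card_mono[OF finite_iv])
  have "iv u v \<noteq> iv p q"
  proof (cases "u = p")
    case True
    then have "v \<in> iv p q"
      using assms by (auto simp: iv_iff)
    moreover have "v \<notin> iv u v"
      by (simp add: iv_iff)
    ultimately show ?thesis
      by blast
  next
    case False
    then have "u \<in> iv p q"
      using assms less_trans[of u v q] by (auto simp: iv_iff)
    moreover have "u \<notin> iv u v"
      by (simp add: iv_iff)
    ultimately show ?thesis
      by blast
  qed
  then show "iv u v \<subset> iv p q"
    using iv_subset assms by blast
qed

lemma boundary_point: "boundary (cell {x}) = cell {}"
  by (simp add: cell_boundary_def)

text \<open>An antichain has no edges, so the only cycles on points are \<open>0\<close> and
  \<open>z\<close>. Any two points form a cycle, hence all pairs equal \<open>z\<close>; a single
  point is not a cycle of the augmented complex.\<close>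

lemma card_antichain_sphere:
  assumes "u \<prec> v" "N u v = 1" and antichain: "\<And>x y. x \<in> iv u v \<Longrightarrow> y \<in> iv u v \<Longrightarrow> \<not> x \<prec> y"
  shows "card (iv u v) = 2"
proof -
  obtain z where z: "sphere_class (\<Delta> u v) 1 z"
    using sphere_class_exists[OF assms(1)] assms(2) by auto
  have layer: "layer (\<Delta> u v) (Suc 1) = {}"
  proof (intro equals0I)
    fix \<sigma> assume "\<sigma> \<in> layer (\<Delta> u v) (Suc 1)"
    then have "card \<sigma> = 2" and \<sigma>: "\<sigma> \<in> \<Delta> u v"
      by simp_all
    then obtain x y where "\<sigma> = {x, y}" "x \<noteq> y"
      by (auto simp: card_2_iff)
    then show False
      using \<sigma> antichain by (auto simp: face_iff)
  qed
  have bd: "boundary ` chains_on (layer (\<Delta> u v) (Suc 1)) = {0}"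
    unfolding chains_on_def layer by auto
  have uniq: "c = 0 \<or> c = z" if "c \<in> chains_on (layer (\<Delta> u v) 1)" "boundary c = 0" for c
  proof -
    have "c \<in> boundary ` chains_on (layer (\<Delta> u v) (Suc 1)) \<or>
        c + z \<in> boundary ` chains_on (layer (\<Delta> u v) (Suc 1))"
      using z that unfolding sphere_class_def by blast
    then show ?thesis
      unfolding bd by (auto simp: bit_chain_add_eq_iff)
  qed
  have point: "cell {x} \<in> chains_on (layer (\<Delta> u v) 1)" if "x \<in> iv u v" for x
    using that by (simp add: face_iff)
  have pair: "cell {x} + cell {y} = z" if "x \<in> iv u v" "y \<in> iv u v" "x \<noteq> y" for x y
  proof -
    have "cell {x} + cell {y} = 0 \<or> cell {x} + cell {y} = z"
      using that point by (intro uniq chains_on_add) (simp_all add: boundary_point del: boundary_cell)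
    moreover have "{x} \<in> Poly_Mapping.keys (cell {x} + cell {y})"
      using that by (auto simp: keys_add_bit)
    ultimately show ?thesis
      by auto
  qed
  have z0: "z \<noteq> 0" "boundary z = 0" "Poly_Mapping.keys z \<subseteq> layer (\<Delta> u v) 1"
    using z sphere_class_nonzero[OF z] by (auto simp: sphere_class_def chains_on_def)
  then obtain \<sigma> where \<sigma>: "\<sigma> \<in> Poly_Mapping.keys z"
    by (metis all_not_in_conv keys_eq_empty)
  then have "\<sigma> \<in> \<Delta> u v" "card \<sigma> = 1"
    using z0(3) by auto
  then obtain a where a: "\<sigma> = {a}" "a \<in> iv u v"
    by (auto simp: card_1_singleton_iff face_iff)
  have "Poly_Mapping.keys z \<noteq> {{a}}"
  proof
    assume "Poly_Mapping.keys z = {{a}}"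
    then have "z = cell {a}"
      by (intro chain_eqI) simp
    then have "boundary z = cell {}"
      by (simp only: boundary_point)
    then show False
      using z0(2) by (metis keys_single keys_zero insert_not_empty zero_neq_one)
  qed
  then obtain \<sigma>' where \<sigma>': "\<sigma>' \<in> Poly_Mapping.keys z" "\<sigma>' \<noteq> {a}"
    using \<sigma> a by blast
  then have "\<sigma>' \<in> \<Delta> u v" "card \<sigma>' = 1"
    using z0(3) by auto
  then obtain b where b: "\<sigma>' = {b}" "b \<in> iv u v"
    by (auto simp: card_1_singleton_iff face_iff)
  have ab: "a \<noteq> b"
    using a b \<sigma>' by auto
  have "c \<in> {a, b}" if c: "c \<in> iv u v" for c
  proof (rule ccontr)
    assume "c \<notin> {a, b}"
    then have "cell {a} + cell {b} = cell {a} + cell {c}"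
      using pair[OF a(2) b(2) ab] pair[OF a(2) c] by auto
    then have "cell {b} = (cell {c} :: 'a set \<Rightarrow>\<^sub>0 bit)"
      by simp
    then show False
      using \<open>c \<notin> {a, b}\<close> by (metis insertI1 insert_commute keys_single singleton_insert_inj_eq zero_neq_one)
  qed
  then have "iv u v = {a, b}"
    using a b by blast
  then show ?thesis
    using ab by simp
qed

lemma R_pos: "R p q \<ge> 1"
  by (simp add: R_def)

section \<open>Induction step for the additivity of \<open>R\<close>\<close>

context
  fixes p q
  assumes pq: "p \<prec> q"
    and additive: "\<And>u v x. \<lbrakk>card (iv u v) < card (iv p q); u \<prec> x; x \<prec> v\<rbrakk> \<Longrightarrow> R u v = R u x + R x v"
begin

lemma additive_sub:
  assumes "p = u \<or> p \<prec> u" "v = q \<or> v \<prec> q" "u \<noteq> p \<or> v \<noteq> q" "u \<prec> x" "x \<prec> v"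
  shows "R u v = R u x + R x v"
  using assms additive card_iv_less less_trans by blast

text \<open>The value that additivity at \<open>x\<close> predicts for \<open>R p q\<close>.\<close>

definition h :: "'a \<Rightarrow> nat" where
  "h x = R p x + R x q"

text \<open>Additivity in the smaller intervals from \<open>p\<close> to \<open>y\<close> and from
  \<open>x\<close> to \<open>q\<close> turns both sides into
  \<open>R p x + R x y + R y q\<close>.\<close>

lemma h_less:
  assumes "p \<prec> x" "x \<prec> y" "y \<prec> q"
  shows "h x = h y"
proof -
  have "p \<prec> y" "x \<prec> q"
    using assms less_trans by blast+
  then have "R p y = R p x + R x y" "R x q = R x y + R y q"
    using assms by (auto intro!: additive_sub)
  then show ?thesis
    by (simp add: h_def)
qed

lemma h_comparable:
  assumes "x \<in> iv p q" "y \<in> iv p q" "x = y \<or> x \<prec> y \<or> y \<prec> x"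
  shows "h x = h y"
  using assms h_less[of x y] h_less[of y x] by (auto simp: iv_iff)

lemma R_mono:
  assumes "p \<prec> x" "x \<prec> y" "y \<prec> q"
  shows "R p x < R p y"
proof -
  have "R p y = R p x + R x y"
    using assms less_trans by (intro additive_sub) auto
  then show ?thesis
    using R_pos[of x y] by simp
qed

lemma inj_on_face:
  assumes "\<sigma> \<in> \<Delta> p q"
  shows "inj_on (R p) \<sigma>"
proof (rule inj_onI)
  fix x y assume xy: "x \<in> \<sigma>" "y \<in> \<sigma>" "R p x = R p y"
  then have "x \<in> iv p q" "y \<in> iv p q" "x = y \<or> x \<prec> y \<or> y \<prec> x"
    using assms unfolding face_iff by blast+
  then show "x = y"
    using R_mono[of x y] R_mono[of y x] xy(3) by (auto simp: iv_iff)
qed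

lemma R_image_face:
  assumes "\<sigma> \<subseteq> {y \<in> iv p q. h y = k}"
  shows "R p ` \<sigma> \<subseteq> {1..k - 1}"
proof
  fix i assume "i \<in> R p ` \<sigma>"
  then obtain y where "y \<in> \<sigma>" "i = R p y"
    by blast
  moreover from this have "R p y + R y q = k"
    using assms by (auto simp: h_def)
  ultimately show "i \<in> {1..k - 1}"
    using R_pos[of p y] R_pos[of y q] by simp
qed

text \<open>On a chain \<open>R p\<close> is injective, and with \<open>h = k\<close> both summands
  of \<open>h\<close> are positive, so its values lie between 1 and \<open>k - 1\<close>.\<close>

lemma card_face_le:
  assumes "\<sigma> \<in> \<Delta> p q" "\<sigma> \<subseteq> {y \<in> iv p q. h y = k}"
  shows "card \<sigma> \<le> k - 1"
proof -
  have "card \<sigma> = card (R p ` \<sigma>)"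
    using inj_on_face[OF assms(1)] by (simp add: card_image)
  also have "\<dots> \<le> card {1..k - 1}"
    using R_image_face[OF assms(2)] by (intro card_mono) auto
  finally show ?thesis
    by simp
qed

lemma R_image_maximal_face:
  assumes "\<sigma> \<in> \<Delta> p q" "\<sigma> \<subseteq> {y \<in> iv p q. h y = k}" "card \<sigma> = k - 1"
  shows "R p ` \<sigma> = {1..k - 1}"
  using R_image_face[OF assms(2)] card_image[OF inj_on_face[OF assms(1)]] assms(3)
  by (intro card_subset_eq) auto

text \<open>By \<open>card_face_le\<close> these are the largest chains possible within the level
  set \<open>h = k\<close>; they are the terms of the fundamental cycle.\<close>

definition maximal_faces :: "nat \<Rightarrow> 'a set set" where
  "maximal_faces k = {\<sigma> \<in> \<Delta> p q. \<sigma> \<subseteq> {y \<in> iv p q. h y = k} \<and> card \<sigma> = k - 1}"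

text \<open>Faces carrying the classes below and above \<open>x\<close> are joined through
  \<open>x\<close>; the size is \<open>N p x + 1 + N x q = h x - 1\<close>.\<close>

lemma maximal_face_exists:
  assumes x: "x \<in> iv p q"
  obtains \<sigma> where "\<sigma> \<in> maximal_faces (h x)"
proof -
  have px: "p \<prec> x" "x \<prec> q"
    using x by (auto simp: iv_iff)
  obtain \<alpha> where \<alpha>: "\<alpha> \<in> \<Delta> p x" "card \<alpha> = N p x"
    using px(1) by (rule face_exists)
  obtain \<beta> where \<beta>: "\<beta> \<in> \<Delta> x q" "card \<beta> = N x q"
    using px(2) by (rule face_exists)
  let ?\<sigma> = "insert x (\<alpha> \<union> \<beta>)"
  have fin: "finite \<alpha>" "finite \<beta>"
    using \<alpha> \<beta> by (auto simp: face_iff)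
  have below: "p \<prec> y" "y \<prec> x" if "y \<in> \<alpha>" for y
    using \<alpha>(1) that by (auto simp: face_iff iv_iff)
  have above: "x \<prec> y" "y \<prec> q" if "y \<in> \<beta>" for y
    using \<beta>(1) that by (auto simp: face_iff iv_iff)
  have ab: "a \<prec> b" if "a \<in> \<alpha>" "b \<in> \<beta>" for a b
    using below(2)[OF that(1)] above(1)[OF that(2)] by (rule less_trans)
  have disj: "\<alpha> \<inter> \<beta> = {}" "x \<notin> \<alpha> \<union> \<beta>"
    using ab below above by fastforce+
  have iv: "?\<sigma> \<subseteq> iv p q"
    using x below above less_trans[OF _ px(2)] less_trans[OF px(1)] by (auto simp: iv_iff)
  have "?\<sigma> \<in> \<Delta> p q"
    unfolding face_iff
  proof (intro conjI ballI)
    fix y w assume "y \<in> ?\<sigma>" "w \<in> ?\<sigma>"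
    then show "y = w \<or> y \<prec> w \<or> w \<prec> y"
      using \<alpha>(1) \<beta>(1) below(2) above(1) ab unfolding face_iff by blast
  qed (use fin iv in auto)
  moreover have "y = x \<or> y \<prec> x \<or> x \<prec> y" if "y \<in> ?\<sigma>" for y
    using that below(2) above(1) by blast
  then have "h y = h x" if "y \<in> ?\<sigma>" for y
    using that iv x by (intro h_comparable) auto
  then have "?\<sigma> \<subseteq> {y \<in> iv p q. h y = h x}"
    using iv by blast
  moreover have "card ?\<sigma> = h x - 1"
    using fin disj \<alpha>(2) \<beta>(2) by (simp add: card_Un_disjoint h_def R_def)
  ultimately have "?\<sigma> \<in> maximal_faces (h x)"
    by (simp add: maximal_faces_def)
  then show thesis
    by (rule that)
qed

text \<open>The values of \<open>R p\<close> along a maximal face run through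
  \<open>1..k - 1\<close> without gaps. So the elements next to \<open>x\<close>, with
  \<open>p\<close> and \<open>q\<close> standing in at the ends, are one step away.\<close>

lemma neighbours:
  assumes k: "k \<ge> 3" and x: "x \<notin> \<tau>" "insert x \<tau> \<in> maximal_faces k"
  obtains u v where "u = p \<or> u \<in> \<tau>" "v = q \<or> v \<in> \<tau>" "u \<prec> x" "x \<prec> v" "R u x = 1" "R x v = 1"
    "u \<noteq> p \<or> v \<noteq> q"
    "\<And>w. w \<in> \<tau> \<Longrightarrow> w = u \<or> w \<prec> u \<or> w = v \<or> v \<prec> w"
proof -
  let ?\<sigma> = "insert x \<tau>"
  have \<sigma>: "?\<sigma> \<in> \<Delta> p q" "?\<sigma> \<subseteq> {y \<in> iv p q. h y = k}"
    and img: "R p ` ?\<sigma> = {1..k - 1}"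
    using x(2) R_image_maximal_face[of ?\<sigma> k] by (auto simp: maximal_faces_def)
  have iv: "p \<prec> y" "y \<prec> q" "R p y + R y q = k" if "y \<in> ?\<sigma>" for y
    using \<sigma>(2) that by (auto simp: iv_iff h_def)
  have comp: "y = w \<or> y \<prec> w \<or> w \<prec> y" if "y \<in> ?\<sigma>" "w \<in> ?\<sigma>" for y w
    using \<sigma>(1) that unfolding face_iff by blast
  have less: "y \<prec> w" if "y \<in> ?\<sigma>" "w \<in> ?\<sigma>" "R p y < R p w" for y w
    using comp[OF that(1,2)] R_mono[of w y] iv that by auto
  have le: "y = w \<or> y \<prec> w" if "y \<in> ?\<sigma>" "w \<in> ?\<sigma>" "R p y \<le> R p w" for y w
    using comp[OF that(1,2)] R_mono[of w y] iv that by auto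
  define i where "i = R p x"
  have i: "1 \<le> i" "i \<le> k - 1"
    using img by (auto simp: i_def)
  have ne: "R p w \<noteq> i" if "w \<in> \<tau>" for w
    using inj_on_face[OF \<sigma>(1)] that x(1) by (auto simp: i_def inj_on_def)
  obtain u where u: "u = p \<and> i = 1 \<or> u \<in> \<tau> \<and> R p u = i - 1" "u \<prec> x" "R u x = 1"
  proof (cases "i = 1")
    case True
    then show thesis
      using that[of p] iv(1)[of x] by (simp add: i_def)
  next
    case False
    then have "i - 1 \<in> R p ` ?\<sigma>"
      using i img by auto
    then obtain u where u: "u \<in> ?\<sigma>" "R p u = i - 1"
      by (metis imageE)
    then have "u \<in> \<tau>"
      using i False by (auto simp: i_def)
    moreover have "u \<prec> x"
      using u i by (intro less) (auto simp: i_def)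
    moreover have "R p x = R p u + R u x"
      using iv[OF u(1)] iv[of x] \<open>u \<prec> x\<close> by (intro additive_sub) auto
    ultimately show thesis
      using that[of u] u i by (simp add: i_def)
  qed
  obtain v where v: "v = q \<and> i = k - 1 \<or> v \<in> \<tau> \<and> R p v = i + 1" "x \<prec> v" "R x v = 1"
  proof (cases "i = k - 1")
    case True
    \<comment> \<open>At the upper end, \<open>h x = k\<close> and \<open>R p x = k - 1\<close>
      leave \<open>R x q = 1\<close>.\<close>
    then show thesis
      using that[of q] iv(2,3)[of x] k by (simp add: i_def)
  next
    case False
    then have "i + 1 \<in> R p ` ?\<sigma>"
      using i img by auto
    then obtain v where v: "v \<in> ?\<sigma>" "R p v = i + 1"
      by (metis imageE)
    then have "v \<in> \<tau>"
      by (auto simp: i_def)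
    moreover have "x \<prec> v"
      using v by (intro less) (auto simp: i_def)
    moreover have "R p v = R p x + R x v"
      using iv[OF v(1)] iv[of x] \<open>x \<prec> v\<close> by (intro additive_sub) auto
    then have "R x v = 1"
      using v(2) unfolding i_def by linarith
    ultimately show thesis
      using v(2) by (intro that[of v]) blast+
  qed
  show thesis
  proof (rule that[of u v])
    \<comment> \<open>Both neighbours are end points only if \<open>i = 1\<close> and
      \<open>i = k - 1\<close>, which \<open>k \<ge> 3\<close> excludes.\<close>
    show "u \<noteq> p \<or> v \<noteq> q"
      using u(1) v(1) k iv[of u] iv[of v] by auto
    fix w assume w: "w \<in> \<tau>"
    have Rw: "R p w \<in> {1..k - 1}"
      using img w by blast
    consider "R p w < i" | "R p w > i"
      using ne[OF w] by linarith
    then show "w = u \<or> w \<prec> u \<or> w = v \<or> v \<prec> w"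
    proof cases
      case 1
      then have "u \<in> \<tau>" "R p w \<le> R p u"
        using u(1) Rw by auto
      then show ?thesis
        using le[of w u] w by auto
    next
      case 2
      then have "v \<in> \<tau>" "R p v \<le> R p w"
        using v(1) Rw by auto
      then show ?thesis
        using le[of v w] w by auto
    qed
  qed (use u v in auto)
qed

text \<open>Removing \<open>x\<close> from a maximal face leaves a gap between \<open>u\<close> and
  \<open>v\<close> with \<open>R u v = 2\<close>. The open interval there is a zero-dimensional
  sphere and an antichain, so it has two points, and these are exactly the completions.\<close>

lemma even_card_completions:
  assumes k: "k \<ge> 3"
  shows "even (card {x. x \<notin> \<tau> \<and> insert x \<tau> \<in> maximal_faces k})"
proof (cases "{x. x \<notin> \<tau> \<and> insert x \<tau> \<in> maximal_faces k} = {}")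
  case True
  then show ?thesis
    by (simp only: card.empty even_zero)
next
  case False
  then obtain x where x: "x \<notin> \<tau>" "insert x \<tau> \<in> maximal_faces k"
    by blast
  then obtain u v where u: "u = p \<or> u \<in> \<tau>" "u \<prec> x" "R u x = 1"
    and v: "v = q \<or> v \<in> \<tau>" "x \<prec> v" "R x v = 1"
    and uv: "u \<noteq> p \<or> v \<noteq> q" and cut: "\<And>w. w \<in> \<tau> \<Longrightarrow> w = u \<or> w \<prec> u \<or> w = v \<or> v \<prec> w"
    using neighbours[OF k x] by metis
  have \<tau>: "finite \<tau>" "\<tau> \<subseteq> {y \<in> iv p q. h y = k}" "card \<tau> = k - 2"
    and comp: "\<And>y w. y \<in> \<tau> \<Longrightarrow> w \<in> \<tau> \<Longrightarrow> y = w \<or> y \<prec> w \<or> w \<prec> y"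
    using x unfolding maximal_faces_def face_iff by auto
  have pu: "p = u \<or> p \<prec> u" and vq: "v = q \<or> v \<prec> q"
    using u(1) v(1) \<tau>(2) by (auto simp: iv_iff)
  have "u \<prec> v"
    using u(2) v(2) by (rule less_trans)
  have "R u v = 2"
    using additive_sub[OF pu vq uv u(2) v(2)] u(3) v(3) by simp
  have rank: "R u y = 1 \<and> R y v = 1" if "y \<in> iv u v" for y
    using additive_sub[OF pu vq uv, of y] that \<open>R u v = 2\<close> R_pos[of u y] R_pos[of y v]
    by (auto simp: iv_iff)
  \<comment> \<open>A relation \<open>y \<prec> y'\<close> inside the gap would give
    \<open>R u y' \<ge> 2\<close>.\<close>
  have "\<not> y \<prec> y'" if y: "y \<in> iv u v" "y' \<in> iv u v" for y y'
  proof
    assume yy: "y \<prec> y'"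
    have "y' \<prec> q"
      using y(2) vq less_trans by (auto simp: iv_iff)
    then have "R u y' = R u y + R y y'"
      using y yy pu by (intro additive_sub) (auto simp: iv_iff)
    then show False
      using rank[OF y(1)] rank[OF y(2)] R_pos[of y y'] by simp
  qed
  then have "card (iv u v) = 2"
    using \<open>R u v = 2\<close> by (intro card_antichain_sphere \<open>u \<prec> v\<close>) (simp_all add: R_def)
  moreover have "{x. x \<notin> \<tau> \<and> insert x \<tau> \<in> maximal_faces k} = iv u v"
  proof (intro equalityI subsetI)
    fix y assume "y \<in> {x. x \<notin> \<tau> \<and> insert x \<tau> \<in> maximal_faces k}"
    then have y: "y \<notin> \<tau>" "insert y \<tau> \<in> maximal_faces k"
      by auto
    \<comment> \<open>Every completion has to supply the one value missing from \<open>R p\<close>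
      applied to \<open>\<tau>\<close>.\<close>
    have Ry: "R p y = R p x"
    proof -
      have inj: "R p w \<notin> R p ` \<tau>" and img: "insert (R p w) (R p ` \<tau>) = {1..k - 1}"
        if "w \<notin> \<tau>" "insert w \<tau> \<in> maximal_faces k" for w
        using that inj_on_face[of "insert w \<tau>"] R_image_maximal_face[of "insert w \<tau>" k]
        by (auto simp: maximal_faces_def)
      show ?thesis
        using inj[OF x] inj[OF y] img[OF x] img[OF y] by (metis insertI1 insertE)
    qed
    have yiv: "p \<prec> y" "y \<prec> q" and ycomp: "\<And>w. w \<in> \<tau> \<Longrightarrow> w \<prec> y \<or> y \<prec> w"
      using y unfolding maximal_faces_def face_iff by (auto simp: iv_iff)
    have xiv: "p \<prec> x" "x \<prec> q"
      using x unfolding maximal_faces_def by (auto simp: iv_iff)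
    have "u \<prec> y"
    proof (rule ccontr)
      assume "\<not> u \<prec> y"
      then have "u \<in> \<tau>" "y \<prec> u"
        using u(1) yiv ycomp by auto
      moreover from this have "p \<prec> u"
        using \<tau>(2) by (auto simp: iv_iff)
      ultimately have "R p y < R p u" "R p u < R p x"
        using R_mono[of y u] R_mono[of u x] yiv xiv u(2) less_trans[OF u(2) xiv(2)] by auto
      then show False
        using Ry by simp
    qed
    moreover have "y \<prec> v"
    proof (rule ccontr)
      assume "\<not> y \<prec> v"
      then have "v \<in> \<tau>" "v \<prec> y"
        using v(1) yiv ycomp by auto
      moreover from this have "v \<prec> q"
        using \<tau>(2) by (auto simp: iv_iff)
      ultimately have "R p v < R p y" "R p x < R p v"
        using R_mono[of v y] R_mono[of x v] yiv xiv v(2) less_trans[OF xiv(1) v(2)] by auto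
      then show False
        using Ry by simp
    qed
    ultimately show "y \<in> iv u v"
      by (simp add: iv_iff)
  next
    fix y assume "y \<in> iv u v"
    then have y: "u \<prec> y" "y \<prec> v"
      by (auto simp: iv_iff)
    have yw: "w \<prec> y \<or> y \<prec> w" if "w \<in> \<tau>" for w
      using cut[OF that] y less_trans by blast
    then have "y \<notin> \<tau>"
      using less_irrefl by blast
    have yiv: "y \<in> iv p q"
      using y pu vq less_trans by (auto simp: iv_iff)
    \<comment> \<open>Since \<open>k \<ge> 3\<close>, \<open>\<tau>\<close> is nonempty, and an
      element of it comparable to \<open>y\<close> carries the value \<open>k\<close> over to
      \<open>h y\<close>.\<close>
    obtain w where w: "w \<in> \<tau>"
      using \<tau>(3) k by fastforce
    have "h y = h w"
      using w yw[OF w] \<tau>(2) yiv by (intro h_comparable) auto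
    then have "h y = k"
      using w \<tau>(2) by auto
    have "insert y \<tau> \<in> \<Delta> p q"
      unfolding face_iff using \<tau>(1,2) yiv comp yw by blast
    then have "insert y \<tau> \<in> maximal_faces k"
      using \<tau> yiv \<open>h y = k\<close> \<open>y \<notin> \<tau>\<close> k by (auto simp: maximal_faces_def)
    then show "y \<in> {x. x \<notin> \<tau> \<and> insert x \<tau> \<in> maximal_faces k}"
      using \<open>y \<notin> \<tau>\<close> by blast
  qed
  ultimately show ?thesis
    by simp
qed

text \<open>
  The sum of the maximal faces through the elements with \<open>h x = k\<close> is a fundamental class: every
  face of codimension one lies in an even number of them.
\<close>

lemma additive_of_fundamental_class:
  assumes x: "x \<in> iv p q" "h x \<ge> 3"
  shows "R p q = h x"
proof -
  let ?k = "h x"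
  let ?c = "sum cell (maximal_faces ?k)"
  have keys: "Poly_Mapping.keys ?c = maximal_faces ?k"
    by (rule keys_sum_cells) (simp add: maximal_faces_def finite_\<Delta>)
  have "N p q = ?k - 1"
  proof (rule sphere_class_degree[OF pq])
    show "?c \<in> chains_on (layer (\<Delta> p q) (?k - 1))"
      unfolding chains_on_def mem_Collect_eq keys by (auto simp: maximal_faces_def)
    show "boundary ?c = 0"
    proof (rule poly_mapping_eqI)
      fix \<tau>
      have "Poly_Mapping.lookup (boundary ?c) \<tau> =
          of_nat (card {y. y \<notin> \<tau> \<and> insert y \<tau> \<in> maximal_faces ?k})"
        using lookup_boundary[of ?c \<tau>] unfolding keys by (simp add: maximal_faces_def face_iff)
      also have "\<dots> = 0"
        using even_card_completions[OF x(2), of \<tau>] by (elim evenE) simp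
      finally show "Poly_Mapping.lookup (boundary ?c) \<tau> = Poly_Mapping.lookup 0 \<tau>"
        by simp
    qed
    show "?c \<notin> boundary ` chains_on (layer (\<Delta> p q) (Suc (?k - 1)))"
    proof
      assume "?c \<in> boundary ` chains_on (layer (\<Delta> p q) (Suc (?k - 1)))"
      then obtain b where b: "b \<in> chains_on (layer (\<Delta> p q) (Suc (?k - 1)))" "?c = boundary b"
        by blast
      obtain \<sigma> where \<sigma>: "\<sigma> \<in> maximal_faces ?k"
        using x(1) by (rule maximal_face_exists)
      then have "\<sigma> \<in> Poly_Mapping.keys (boundary b)"
        using keys b(2) by simp
      then obtain \<sigma>' y where \<sigma>': "\<sigma>' \<in> Poly_Mapping.keys b" "\<sigma> = \<sigma>' - {y}"
        by (rule keys_boundaryD)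
      have face: "\<sigma>' \<in> \<Delta> p q" "card \<sigma>' = Suc (?k - 1)"
        using \<sigma>'(1) b(1) by (auto simp: chains_on_def)
      \<comment> \<open>A nonempty \<open>\<sigma>\<close> forces the coface
        \<open>\<sigma>'\<close> into the same level set of \<open>h\<close>, where chains have at
        most \<open>h x - 1\<close> elements.\<close>
      have "\<sigma> \<noteq> {}"
        using \<sigma> x(2) by (auto simp: maximal_faces_def)
      then obtain w where w: "w \<in> \<sigma>"
        by blast
      have "h w' = ?k" if "w' \<in> \<sigma>'" for w'
      proof -
        have "h w' = h w"
          using w face(1) that \<sigma>'(2) unfolding face_iff by (intro h_comparable) blast+
        then show ?thesis
          using w \<sigma> by (auto simp: maximal_faces_def)
      qed
      then have "\<sigma>' \<subseteq> {y \<in> iv p q. h y = ?k}"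
        using face(1) by (auto simp: face_iff)
      then show False
        using card_face_le[OF face(1)] face(2) by fastforce
    qed
  qed
  then show ?thesis
    using x(2) by (simp add: R_def)
qed

text \<open>\<open>h x = 2\<close> makes \<open>R p x\<close> and \<open>R x q\<close> both one, so
  anything comparable to \<open>x\<close> would make one of them at least two. With a second point
  \<open>y\<close>, the cycle of \<open>x\<close> and \<open>y\<close> cannot bound, as no edge
  contains \<open>x\<close>.\<close>

lemma additive_of_isolated_point:
  assumes x: "x \<in> iv p q" "h x = 2"
  shows "R p q = 2"
proof -
  have px: "p \<prec> x" "x \<prec> q" "R p x = 1" "R x q = 1"
    using x R_pos[of p x] R_pos[of x q] by (auto simp: iv_iff h_def)
  have isolated: "\<not> x \<prec> y" "\<not> y \<prec> x" if y: "y \<in> iv p q" for y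
  proof -
    show "\<not> x \<prec> y"
    proof
      assume "x \<prec> y"
      moreover from this have "R x q = R x y + R y q"
        using y px by (intro additive_sub) (auto simp: iv_iff)
      ultimately show False
        using px(4) R_pos[of x y] R_pos[of y q] by simp
    qed
    show "\<not> y \<prec> x"
    proof
      assume "y \<prec> x"
      moreover from this have "R p x = R p y + R y x"
        using y px by (intro additive_sub) (auto simp: iv_iff)
      ultimately show False
        using px(3) R_pos[of p y] R_pos[of y x] by simp
    qed
  qed
  have "N p q = 1"
  proof (cases "iv p q = {x}")
    case True
    obtain \<sigma> where \<sigma>: "\<sigma> \<in> \<Delta> p q" "card \<sigma> = N p q"
      using pq by (rule face_exists)
    have "\<sigma> \<subseteq> {x}"
      using \<sigma>(1) True unfolding face_iff by simp
    then have "N p q \<le> 1"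
      using card_mono[of "{x}" \<sigma>] \<sigma>(2) by simp
    \<comment> \<open>Once a point exists, the empty face is its boundary, so no class survives in
      dimension -1.\<close>
    moreover have "N p q \<noteq> 0"
    proof
      assume N0: "N p q = 0"
      obtain z where z: "sphere_class (\<Delta> p q) 0 z"
        using sphere_class_exists[OF pq] N0 by auto
      have "Poly_Mapping.keys z \<subseteq> {{}}"
        using z by (auto simp: sphere_class_def chains_on_def face_iff)
      then have "Poly_Mapping.keys z = {{}}"
        using sphere_class_nonzero[OF z] by (metis keys_eq_empty subset_singletonD)
      then have "z = boundary (cell {x})"
        unfolding boundary_point by (intro chain_eqI) simp
      moreover have "cell {x} \<in> chains_on (layer (\<Delta> p q) (Suc 0))"
        using x(1) by (simp add: face_iff)
      ultimately show False
        using z unfolding sphere_class_def by blast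
    qed
    ultimately show ?thesis
      by simp
  next
    case False
    then obtain y where y: "y \<in> iv p q" "y \<noteq> x"
      using x(1) by blast
    let ?c = "cell {x} + cell {y}"
    show ?thesis
    proof (rule sphere_class_degree[OF pq])
      show "?c \<in> chains_on (layer (\<Delta> p q) 1)"
        using x(1) y(1) by (intro chains_on_add) (auto simp: face_iff)
      show "boundary ?c = 0"
        by (simp add: boundary_point del: boundary_cell)
      show "?c \<notin> boundary ` chains_on (layer (\<Delta> p q) (Suc 1))"
      proof
        assume "?c \<in> boundary ` chains_on (layer (\<Delta> p q) (Suc 1))"
        then obtain b where b: "b \<in> chains_on (layer (\<Delta> p q) (Suc 1))" "?c = boundary b"
          by blast
        have "{x} \<in> Poly_Mapping.keys ?c"
          using y(2) by (simp add: keys_add_bit)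
        then have "{x} \<in> Poly_Mapping.keys (boundary b)"
          unfolding b(2) .
        then obtain \<sigma> w where \<sigma>: "\<sigma> \<in> Poly_Mapping.keys b" "w \<in> \<sigma>" "{x} = \<sigma> - {w}"
          by (rule keys_boundaryD)
        then have "x \<in> \<sigma>" "w \<noteq> x" "\<sigma> \<in> \<Delta> p q"
          using b(1) by (auto simp: chains_on_def)
        then have "w \<in> iv p q" "x \<prec> w \<or> w \<prec> x"
          using \<sigma>(2) unfolding face_iff by blast+
        then show False
          using isolated by blast
      qed
    qed
  qed
  then show ?thesis
    by (simp add: R_def)
qed

end

text \<open>Strong induction on the size of the open interval; as \<open>R\<close> is at least one,
  only \<open>h \<ge> 3\<close> and \<open>h = 2\<close> can occur.\<close>

lemma R_additive:
  assumes "p \<prec> x" "x \<prec> q"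
  shows "R p q = R p x + R x q"
  using assms
proof (induction "card (iv p q)" arbitrary: p x q rule: less_induct)
  case less
  have pq: "p \<prec> q"
    using less.prems by (rule less_trans)
  have add: "R u v = R u y + R y v" if "card (iv u v) < card (iv p q)" "u \<prec> y" "y \<prec> v" for u v y
    using less.hyps that by blast
  have x: "x \<in> iv p q"
    using less.prems by (simp add: iv_iff)
  have "R p q = h p q x"
  proof (cases "h p q x \<ge> 3")
    case True
    with x show ?thesis
      by (intro additive_of_fundamental_class[OF pq add])
  next
    case False
    moreover have "h p q x \<ge> 2"
      using R_pos[of p x] R_pos[of x q] by (simp add: h_def[OF pq add])
    ultimately have "h p q x = 2"
      by simp
    with x show ?thesis
      using additive_of_isolated_point[OF pq add] by simp
  qed
  then show ?case
    by (simp add: h_def[OF pq add])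
qed

end

section \<open>The rank function obtained from additivity\<close>

lemma gorenstein_star_if_spherical:
  assumes "finite P" "bounded_poset P r"
    and sph: "\<And>p q. (p, q) \<in> r \<Longrightarrow> p \<noteq> q \<Longrightarrow>
      \<exists>n z. sphere_class (order_complex (open_interval r p q) r) n z"
  shows "gorenstein_star P r"
proof -
  obtain N where N: "\<And>p q. (p, q) \<in> r \<Longrightarrow> p \<noteq> q \<Longrightarrow>
      \<exists>z. sphere_class (order_complex (open_interval r p q) r) (N p q) z"
    using sph by metis
  have po: "partial_order_on P r"
    using assms(2) by (simp add: bounded_poset_def)
  interpret spherical_poset P r N
    using assms(1) po N by unfold_locales
  obtain a where a: "a \<in> P" "\<And>x. x \<in> P \<Longrightarrow> (a, x) \<in> r"
    using assms(2) by (auto simp: bounded_poset_def)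
  \<comment> \<open>Zero is set explicitly at the minimum, since \<open>N\<close> is constrained
    only for distinct end points.\<close>
  define \<rho> where "\<rho> x = (if x = a then 0 else R a x)" for x
  have \<rho>: "\<rho> q = \<rho> p + R p q" if "p \<prec> q" for p q
  proof -
    have "p = a \<or> a \<prec> p"
      using a less_in_P(1)[OF that] by (auto simp: less_def)
    moreover have "q \<noteq> a"
      using that \<open>p = a \<or> a \<prec> p\<close> less_antisym by auto
    ultimately show ?thesis
      using that R_additive[of a p q] by (auto simp: \<rho>_def)
  qed
  have "rank_function P r \<rho>"
    unfolding rank_function_def
  proof (intro conjI ballI impI)
    fix x assume "x \<in> P" "\<forall>y\<in>P. (y, x) \<in> r \<longrightarrow> y = x"
    then show "\<rho> x = 0"
      using a by (auto simp: \<rho>_def)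
  next
    fix p q assume "covers r p q"
    then have "p \<prec> q" "iv p q = {}"
      by (auto simp: covers_def less_def)
    \<comment> \<open>An empty open interval has \<open>N = 0\<close>, hence
      \<open>R = 1\<close>.\<close>
    then show "\<rho> q = Suc (\<rho> p)"
      using \<rho> N_eq_0 by (simp add: R_def)
  qed
  moreover have "homology_sphere (\<Delta> p q) (int (\<rho> q) - int (\<rho> p) - 2)" if "p \<prec> q" for p q
  proof -
    have "int (\<rho> q) - int (\<rho> p) - 2 = int (N p q) - 1"
      using \<rho>[OF that] by (simp add: R_def)
    then show ?thesis
      unfolding homology_sphere_iff[OF simplicial_complex_order_complex]
      using sphere_class_exists[OF that] by metis
  qed
  ultimately show ?thesis
    using assms(1,2) unfolding gorenstein_star_def less_def by blast
qed

section \<open>Fixed points of an involution\<close>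

theorem theorem3p4:
  fixes P :: "'a set" and r :: "'a rel" and \<nu> :: "'a \<Rightarrow> 'a"
  assumes "gorenstein_star P r"
    and "poset_automorphism P r \<nu>"
    and "\<forall>x\<in>P. \<nu> (\<nu> x) = x"
  shows "gorenstein_star (fixed_points P \<nu>) (Restr r (fixed_points P \<nu>))"
proof -
  let ?F = "fixed_points P \<nu>"
  let ?s = "Restr r ?F"
  have fin: "finite P" and bdd: "bounded_poset P r"
    using assms(1) by (auto simp: gorenstein_star_def)
  have po: "partial_order_on P r"
    using bdd by (simp add: bounded_poset_def)
  have rP: "x \<in> P" "y \<in> P" if "(x, y) \<in> r" for x y
    using that po by (auto simp: partial_order_on_def preorder_on_def)
  have anti: "x = y" if "(x, y) \<in> r" "(y, x) \<in> r" for x y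
    using that po by (auto simp: partial_order_on_def dest: antisymD)
  have refl: "(x, x) \<in> r" if "x \<in> P" for x
    using that po by (auto simp: partial_order_on_def preorder_on_def refl_on_def)
  have \<nu>P: "\<nu> x \<in> P" if "x \<in> P" for x
    using assms(2) that by (auto simp: poset_automorphism_def bij_betw_def)
  have mono: "(\<nu> x, \<nu> y) \<in> r" if "(x, y) \<in> r" for x y
    using assms(2) rP[OF that] that by (auto simp: poset_automorphism_def)
  have "finite ?F"
    using fin by (simp add: fixed_points_def)
  moreover have "bounded_poset ?F ?s"
    unfolding bounded_poset_def
  proof (intro conjI)
    have "refl_on ?F ?s"
      by (auto simp: refl_on_def fixed_points_def refl)
    moreover have "trans ?s" "antisym ?s"
      using po by (auto simp: partial_order_on_def preorder_on_def intro: trans_Restr antisym_subset)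
    ultimately show "partial_order_on ?F ?s"
      by (auto simp: partial_order_on_def preorder_on_def)
    obtain a where a: "a \<in> P" "\<And>x. x \<in> P \<Longrightarrow> (a, x) \<in> r"
      using bdd by (auto simp: bounded_poset_def)
    \<comment> \<open>Applying \<open>\<nu>\<close> to the relation between \<open>a\<close> and
      \<open>\<nu> a\<close> reverses it; antisymmetry then fixes the minimum.\<close>
    have "(\<nu> a, a) \<in> r"
      using mono[OF a(2)[OF \<nu>P[OF a(1)]]] assms(3) a(1) by simp
    then have "\<nu> a = a"
      using a \<nu>P anti by blast
    then show "\<exists>a\<in>?F. \<forall>x\<in>?F. (a, x) \<in> ?s"
      using a by (intro bexI[of _ a]) (auto simp: fixed_points_def)
    obtain b where b: "b \<in> P" "\<And>x. x \<in> P \<Longrightarrow> (x, b) \<in> r"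
      using bdd by (auto simp: bounded_poset_def)
    have "(b, \<nu> b) \<in> r"
      using mono[OF b(2)[OF \<nu>P[OF b(1)]]] assms(3) b(1) by simp
    then have "\<nu> b = b"
      using b \<nu>P anti by blast
    then show "\<exists>b\<in>?F. \<forall>x\<in>?F. (x, b) \<in> ?s"
      using b by (intro bexI[of _ b]) (auto simp: fixed_points_def)
  qed
  moreover have "\<exists>n z. sphere_class (order_complex (open_interval ?s p q) ?s) n z"
    if pq: "(p, q) \<in> ?s" "p \<noteq> q" for p q
  proof -
    let ?K = "order_complex (open_interval r p q) r"
    have p: "(p, q) \<in> r" "\<nu> p = p" "\<nu> q = q" "p \<in> P" "q \<in> P"
      using pq(1) by (auto simp: fixed_points_def)
    have face: "\<sigma> \<in> ?K \<longleftrightarrow> finite \<sigma> \<and> (\<forall>x\<in>\<sigma>. (p, x) \<in> r \<and> x \<noteq> p \<and> (x, q) \<in> r \<and> x \<noteq> q) \<and>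
        (\<forall>x\<in>\<sigma>. \<forall>y\<in>\<sigma>. (x, y) \<in> r \<or> (y, x) \<in> r)" for \<sigma>
      by (auto simp: order_complex_def open_interval_def Chains_def)
    have \<nu>\<nu>: "\<nu> (\<nu> x) = x" if "(p, x) \<in> r" for x
      using assms(3) rP(2)[OF that] by blast
    interpret regular_involution ?K \<nu>
    proof
      show "simplicial_complex ?K"
        by (rule simplicial_complex_order_complex)
      have "open_interval r p q \<subseteq> P"
        using rP(2) unfolding open_interval_def by blast
      then have "?K \<subseteq> Pow P"
        unfolding order_complex_def by blast
      then show "finite ?K"
        using fin by (auto intro: finite_subset)
    next
      fix \<sigma> assume \<sigma>: "\<sigma> \<in> ?K"
      have "(p, \<nu> x) \<in> r \<and> \<nu> x \<noteq> p \<and> (\<nu> x, q) \<in> r \<and> \<nu> x \<noteq> q" if "x \<in> \<sigma>" for x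
      proof -
        have x: "(p, x) \<in> r" "x \<noteq> p" "(x, q) \<in> r" "x \<noteq> q"
          using \<sigma> that by (auto simp: face)
        then show ?thesis
          using mono[of p x] mono[of x q] p(2,3) \<nu>\<nu>[of x] by auto
      qed
      then show "\<nu> ` \<sigma> \<in> ?K"
        using \<sigma> mono unfolding face by blast
      fix x assume x: "x \<in> \<sigma>"
      show inv: "\<nu> (\<nu> x) = x"
        using \<sigma> x \<nu>\<nu> by (auto simp: face)
      assume "\<nu> ` \<sigma> = \<sigma>"
      \<comment> \<open>In an invariant chain \<open>x\<close> and \<open>\<nu> x\<close> are
        comparable, and \<open>\<nu>\<close> reverses the comparison, so they coincide. This is
        regularity.\<close>
      then have "(x, \<nu> x) \<in> r \<or> (\<nu> x, x) \<in> r"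
        using \<sigma> x unfolding face by blast
      then show "\<nu> x = x"
        using mono[of x "\<nu> x"] mono[of "\<nu> x" x] inv anti by auto
    qed
    \<comment> \<open>Chains of fixed points in the interval of \<open>P\<close> are the chains of
      the interval in the induced subposet, so \<open>smith\<close> speaks about the latter.\<close>
    have "F = order_complex (open_interval ?s p q) ?s"
    proof (rule Set.set_eqI)
      fix \<sigma>
      show "\<sigma> \<in> F \<longleftrightarrow> \<sigma> \<in> order_complex (open_interval ?s p q) ?s"
        using p rP unfolding F_def mem_Collect_eq face
        by (auto simp: order_complex_def open_interval_def Chains_def fixed_points_def)
    qed
    moreover obtain d where "homology_sphere ?K d"
      using assms(1) p pq(2) unfolding gorenstein_star_def by blast
    then obtain n z where "sphere_class ?K n z"
      unfolding homology_sphere_iff[OF simplicial_complex_order_complex] by blast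
    ultimately show ?thesis
      using smith by simp
  qed
  ultimately show ?thesis
    by (rule gorenstein_star_if_spherical)
qed

end
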